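(* Let $p$ be an odd prime and let $G$ be a finite group satisfying the property $\mathcal{P}(2p;x,y)$ for some $x,y\in G$. If $p=3$ then $|G|\ge96$, and if $p=5$ then $|G|\ge320$.
   Context: For a finite group $G$ and $\ell\ge1$, $r_\ell(g)=\#\{h\in G:h^\ell=g\}$. For a positive squarefree integer $d$, a finite group $G$ satisfies the property $\mathcal{P}(d;x,y)$ if $x,y\in G$ are elements of the same order such that $r_\ell(x)=r_\ell(y)$ for all (positive) squarefree integers $\ell<d$, and $r_d(x)<r_d(y)$. *)

theory Defs
  imports "HOL-Algebra.Algebra" "HOL-Computational_Algebra.Squarefree"
begin

definition root_count :: "('a, 'b) monoid_scheme \<Rightarrow> nat \<Rightarrow> 'a \<Rightarrow> nat" where
  "root_count G l g = card {h \<in> carrier G. h [^]\<^bsub>G\<^esub> l = g}"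

text \<open>The property P(d;x,y). It is meant for a finite group G and a squarefree d; these are
  standing hypotheses, not part of the definition. Note that 0 is not squarefree, so l
  ranges over positive integers.\<close>

definition property_P :: "('a, 'b) monoid_scheme \<Rightarrow> nat \<Rightarrow> 'a \<Rightarrow> 'a \<Rightarrow> bool" where
  "property_P G d x y \<longleftrightarrow>
     x \<in> carrier G \<and> y \<in> carrier G \<and> group.ord G x = group.ord G y \<and>
     (\<forall>l. squarefree l \<and> l < d \<longrightarrow> root_count G l x = root_count G l y) \<and>
     root_count G d x < root_count G d y"

end

theory Submission
  imports Defs
begin

text \<open>
  Let \<open>p\<close> be an odd prime. Sending \<open>h\<close> to \<open>(h\<^sup>2, h\<^sup>p)\<close> identifies the \<open>2p\<close>-th roots of \<open>g\<close>
  with the commuting pairs \<open>(v, u)\<close> of a \<open>p\<close>-th root and a square root of \<open>g\<close>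
  (\<open>root_count_double\<close>). So the property says that \<open>x\<close> and \<open>y\<close>, of common order \<open>n\<close>,
  have equally many square roots and equally many \<open>p\<close>-th roots, but that these commute
  less often over \<open>x\<close>. A pair over \<open>x\<close> that does not commute has orders \<open>2n\<close> and \<open>pn\<close>,
  whence \<open>2pn\<close> divides the order of \<open>G\<close> (\<open>twice_prime_ord_dvd_order\<close>).

  Root counts do not change under conjugation or when an element is replaced by another
  generator of the same cyclic group. So it suffices to show, below the claimed bounds,
  that \<open>x\<close> is conjugate to a power of \<open>y\<close>, or to find some other contradiction.

  If \<open>p\<^sup>2\<close> divides the order of \<open>G\<close>, then that order is \<open>2p\<^sup>2t\<close> with \<open>t \<le> 6\<close>, and for each
  prime \<open>q\<close> dividing \<open>n\<close> the Sylow \<open>q\<close>-subgroups are so small that the \<open>q\<close>-part of \<open>x\<close> is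
  conjugate to a power of the \<open>q\<close>-part of \<open>y\<close>. For \<open>q = 2\<close> and \<open>q = p\<close> this uses that \<open>x\<close> and \<open>y\<close>
  have \<open>q\<close>-th roots, whose \<open>q\<close>-parts generate subgroups of index at most \<open>q\<close> in a Sylow subgroup.
  Working one prime at a time inside centralisers, \<open>conj_into_cyclic_subgroup\<close> makes \<open>x\<close>
  itself conjugate to a power of \<open>y\<close>.

  If \<open>p\<^sup>2\<close> does not divide the order of \<open>G\<close>, then all subgroups of order \<open>p\<close> are conjugate. After
  a conjugation, \<open>x\<close> and \<open>y\<close> both centralise one element \<open>b\<close> of order \<open>p\<close> such that \<open>x\<close> has
  fewer square roots commuting with \<open>b\<close> than \<open>y\<close>. Since \<open>b\<close> permutes the square roots in \<open>G\<close>,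
  whose numbers agree, the two counts are congruent modulo \<open>p\<close>. The quotient \<open>E\<close> of the
  centraliser of \<open>b\<close> by \<open>\<langle>b\<rangle>\<close> keeps this gap (\<open>reduction_to_central_quotient\<close>) and is small: the
  centraliser is proper, so \<open>2p\<close> times the order of \<open>E\<close> is at most the order of \<open>G\<close>, which leaves
  orders up to 15 for \<open>p = 3\<close> and up to 31 for \<open>p = 5\<close>. A gap of at least \<open>p\<close>, doubled when \<open>n\<close> is
  even, demands more room in the centraliser of \<open>y\<close> than \<open>E\<close> has, apart from a few orders that
  are excluded by their structure (\<open>no_root_gap\<close>).
\<close>

section \<open>Fixed points of permutations of prime-power order\<close>

lemma funpow_in:
  assumes "\<And>t. t \<in> T \<Longrightarrow> f t \<in> T" "t \<in> T"
  shows "(f ^^ i) t \<in> T"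
  using assms by (induction i) auto

text \<open>
  The orbit of a point that is not fixed has exactly \<open>q\<close> elements, so it can be removed from \<open>T\<close>
  without changing the cardinality modulo \<open>q\<close> or the fixed points. Only the elements of \<open>T\<close> need to
  return to themselves, so that \<open>f\<close> may be any function given by a group expression.
\<close>
lemma card_fixed_points_cong_prime:
  fixes f :: "'x \<Rightarrow> 'x"
  assumes q: "Factorial_Ring.prime (q::nat)" and "finite T"
    and "\<And>t. t \<in> T \<Longrightarrow> f t \<in> T" and "\<And>t. t \<in> T \<Longrightarrow> (f ^^ q) t = t"
  shows "card T mod q = card {t \<in> T. f t = t} mod q"
  using assms(2-)
proof (induction "card T" arbitrary: T rule: less_induct)
  case less
  note fin = less.prems(1) and cl = less.prems(2) and per = less.prems(3)
  show ?case
  proof (cases "\<forall>t\<in>T. f t = t")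
    case True
    then have "{t \<in> T. f t = t} = T" by auto
    then show ?thesis by simp
  next
    case False
    then obtain t where t: "t \<in> T" "f t \<noteq> t" by auto
    define Orb where "Orb = (\<lambda>i. (f ^^ i) t) ` {..<q}"
    have q0: "0 < q" using q prime_gt_0_nat by blast
    have per_mult: "(f ^^ (q * m)) s = s" if "s \<in> T" for m s
      using that by (induction m) (simp_all add: funpow_add per)
    have inj: "inj_on (\<lambda>i. (f ^^ i) t) {..<q}"
    proof -
      have False if ij: "i < j" "j < q" and eq: "(f ^^ i) t = (f ^^ j) t" for i j
      proof -
        have "(f ^^ (q - i)) ((f ^^ i) t) = (f ^^ (q - i)) ((f ^^ j) t)" using eq by simp
        then have "(f ^^ (q - i + i)) t = (f ^^ (q - i + j)) t"
          by (simp only: funpow_add comp_apply)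
        moreover have "q - i + i = q" "q - i + j = q + (j - i)" using ij by linarith+
        ultimately have "(f ^^ q) t = (f ^^ (q + (j - i))) t" by (simp only:)
        moreover have "(f ^^ (q + (j - i))) t = (f ^^ (j - i)) ((f ^^ q) t)"
          by (metis add.commute comp_apply funpow_add)
        ultimately have d: "(f ^^ (j - i)) t = t" using per t by simp
        have dm: "(f ^^ ((j - i) * m)) t = t" for m
          by (induction m) (simp_all add: funpow_add d)
        have "coprime (j - i) q"
        proof -
          have "\<not> q dvd j - i" using ij by (intro nat_dvd_not_less) auto
          then show ?thesis using q prime_imp_coprime coprime_commute by blast
        qed
        then obtain a b where "(j - i) * a = q * b + 1"
          using bezout_nat[of "j - i" q] ij by (auto simp: coprime_iff_gcd_eq_1)
        then have "(f ^^ (q * b + 1)) t = t" using dm[of a] by simp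
        moreover have "(f ^^ (q * b + 1)) t = f t"
          using per_mult[OF cl[OF t(1)]] by (simp add: funpow_swap1)
        ultimately show False using t by simp
      qed
      then show ?thesis by (intro linorder_inj_onI) auto
    qed
    have cO: "card Orb = q" unfolding Orb_def using inj by (simp add: card_image)
    have OT: "Orb \<subseteq> T" unfolding Orb_def using funpow_in[of T f t] cl t by auto
    have pull: "s \<in> Orb" if sT: "s \<in> T" and fs: "f s \<in> Orb" for s
    proof -
      obtain i where i: "f s = (f ^^ i) t" "i < q" using fs unfolding Orb_def by blast
      have "s = (f ^^ (q - 1)) (f s)"
        using per[OF sT] q0 by (metis Suc_diff_1 comp_apply funpow_Suc_right)
      also have "\<dots> = (f ^^ (q - 1 + i)) t" by (simp only: i(1) funpow_add comp_apply)
      also have "\<dots> = (f ^^ ((q - 1 + i) mod q)) t"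
      proof -
        have "(f ^^ ((q - 1 + i) mod q + q * ((q - 1 + i) div q))) t = (f ^^ ((q - 1 + i) mod q)) t"
          by (simp only: funpow_add comp_apply per_mult[OF t(1)])
        then show ?thesis by (simp only: mod_mult_div_eq)
      qed
      finally show ?thesis unfolding Orb_def using q0 by auto
    qed
    have fixO: "f s \<noteq> s" if sO: "s \<in> Orb" for s
    proof
      assume fs: "f s = s"
      obtain i where i: "s = (f ^^ i) t" "i < q" using sO unfolding Orb_def by blast
      have "(f ^^ m) s = s" for m using fs by (induction m) auto
      then have "s = (f ^^ (q - i)) s" by simp
      also have "\<dots> = (f ^^ (q - i + i)) t" using i by (simp only: funpow_add comp_apply)
      also have "\<dots> = t" using i per t by simp
      finally show False using fs t by simp
    qed
    have "card (T - Orb) mod q = card {s \<in> T - Orb. f s = s} mod q"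
    proof (rule less.hyps)
      show "card (T - Orb) < card T"
        using cO OT fin q0 t by (metis card_Diff_subset card_gt_0_iff diff_less empty_iff finite_subset)
    qed (use fin cl per pull in auto)
    moreover have "{s \<in> T - Orb. f s = s} = {s \<in> T. f s = s}" using fixO by auto
    moreover have "card T = card (T - Orb) + q"
      using card_Diff_subset[OF finite_subset[OF OT fin] OT] card_mono[OF fin OT] cO by simp
    ultimately show ?thesis by simp
  qed
qed

text \<open>
  The fixed points of \<open>f\<^bsup>q^k\<^esup>\<close> are permuted by \<open>f\<close>, so the prime case can be iterated. This
  replaces actions of \<open>q\<close>-groups: only cyclic ones are needed below.
\<close>
lemma card_fixed_points_cong:
  fixes f :: "'x \<Rightarrow> 'x"
  assumes q: "Factorial_Ring.prime (q::nat)" and "finite T"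
    and "\<And>t. t \<in> T \<Longrightarrow> f t \<in> T" and "\<And>t. t \<in> T \<Longrightarrow> (f ^^ (q ^ k)) t = t"
  shows "card T mod q = card {t \<in> T. f t = t} mod q"
  using assms(2-)
proof (induction k arbitrary: T)
  case 0
  then have "{t \<in> T. f t = t} = T" by auto
  then show ?case by simp
next
  case (Suc k)
  let ?g = "f ^^ (q ^ k)"
  let ?F = "{t \<in> T. ?g t = t}"
  have "(?g ^^ q) t = t" if "t \<in> T" for t
    using Suc.prems(3)[OF that] by (simp add: funpow_mult mult.commute)
  then have 1: "card T mod q = card ?F mod q"
    using Suc.prems by (intro card_fixed_points_cong_prime[OF q]) (auto intro!: funpow_in)
  have "card ?F mod q = card {t \<in> ?F. f t = t} mod q"
    by (rule Suc.IH) (use Suc.prems in \<open>auto simp: funpow_swap1[symmetric]\<close>)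
  moreover have "{t \<in> ?F. f t = t} = {t \<in> T. f t = t}"
  proof -
    have "(f ^^ m) t = t" if "f t = t" for m t using that by (induction m) auto
    then show ?thesis by auto
  qed
  ultimately show ?case using 1 by simp
qed

section \<open>Conjugation, centralisers and root counts\<close>

text \<open>
  Take for \<open>t\<close> the product of the primes that divide \<open>N\<close> but not \<open>j\<close>. Exponents that are invertible
  modulo the order of an element can thus be made invertible modulo the order of the group.
\<close>
lemma coprime_shift_exists:
  fixes j n N :: nat
  assumes "coprime j n" "N > 0"
  shows "\<exists>t. coprime (j + n * t) N"
proof -
  define t where "t = \<Prod>{q \<in> prime_factors N. \<not> q dvd j}"
  have fin: "finite {q \<in> prime_factors N. \<not> q dvd j}" by simp
  have t_dvd: "q dvd t \<longleftrightarrow> \<not> q dvd j" if q: "Factorial_Ring.prime q" "q dvd N" for q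
  proof -
    have "q dvd t \<longleftrightarrow> (\<exists>r\<in>{q \<in> prime_factors N. \<not> q dvd j}. q dvd r)"
      unfolding t_def using prime_dvd_prod_iff[OF fin q(1), of "\<lambda>r. r"] by simp
    also have "\<dots> \<longleftrightarrow> \<not> q dvd j"
      using q assms(2) by (auto simp: prime_factors_dvd dest: primes_dvd_imp_eq)
    finally show ?thesis .
  qed
  have "\<not> q dvd j + n * t" if q: "Factorial_Ring.prime q" "q dvd N" for q
  proof (cases "q dvd j")
    case True
    then have "\<not> q dvd n" using assms(1) q(1)
      by (metis coprime_common_divisor_nat not_prime_1)
    then have "\<not> q dvd n * t" using True t_dvd[OF q] q(1) prime_dvd_mult_iff by blast
    then show ?thesis using True by (simp add: dvd_add_right_iff)
  next
    case False
    then have "q dvd n * t" using t_dvd[OF q] by simp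
    then show ?thesis using False by (simp add: dvd_add_left_iff)
  qed
  then have "gcd (j + n * t) N = 1"
    by (metis gcd_nat.boundedE order_refl prime_factor_nat)
  then show ?thesis by (auto simp: coprime_iff_gcd_eq_1)
qed

context group
begin

lemma pow_eq_iff_mod:
  assumes "x \<in> carrier G"
  shows "x [^] (i::nat) = x [^] (j::nat) \<longleftrightarrow> i mod ord x = j mod ord x"
proof -
  have "x [^] i = x [^] j \<longleftrightarrow> int (ord x) dvd int j - int i"
    using int_pow_eq[OF assms, of "int i" "int j"] by (simp add: int_pow_int)
  also have "\<dots> \<longleftrightarrow> int j mod int (ord x) = int i mod int (ord x)"
    by (simp add: mod_eq_dvd_iff)
  also have "\<dots> \<longleftrightarrow> i mod ord x = j mod ord x"
    by (metis of_nat_eq_iff of_nat_mod)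
  finally show ?thesis .
qed

lemma generate_singleton_eq_powers:
  assumes "finite (carrier G)" "b \<in> carrier G"
  shows "generate G {b} = range (\<lambda>k::nat. b [^] k)"
proof -
  have "ord b \<noteq> 0" using ord_ge_1[OF assms] by simp
  then show ?thesis using generate_pow_nat[OF assms(2)] by auto
qed

lemma conj_mult_distrib:
  assumes "z \<in> carrier G" "x \<in> carrier G" "y \<in> carrier G"
  shows "(z \<otimes> x \<otimes> inv z) \<otimes> (z \<otimes> y \<otimes> inv z) = z \<otimes> (x \<otimes> y) \<otimes> inv z"
proof -
  have "inv z \<otimes> (z \<otimes> (y \<otimes> inv z)) = y \<otimes> inv z"
    using assms by (simp flip: m_assoc)
  then show ?thesis using assms by (simp add: m_assoc)
qed

lemma conj_pow:
  assumes "z \<in> carrier G" "x \<in> carrier G"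
  shows "(z \<otimes> x \<otimes> inv z) [^] (i::nat) = z \<otimes> x [^] i \<otimes> inv z"
  using assms by (induction i) (simp_all add: conj_mult_distrib)

lemma conj_inj:
  assumes "z \<in> carrier G" "x \<in> carrier G" "y \<in> carrier G"
  shows "z \<otimes> x \<otimes> inv z = z \<otimes> y \<otimes> inv z \<longleftrightarrow> x = y"
  using assms by simp

lemma conj_inverse:
  assumes "z \<in> carrier G" "x \<in> carrier G"
  shows "z \<otimes> (inv z \<otimes> x \<otimes> z) \<otimes> inv z = x" "inv z \<otimes> (z \<otimes> x \<otimes> inv z) \<otimes> z = x"
proof -
  have *: "z \<otimes> (inv z \<otimes> x) = x" "inv z \<otimes> (z \<otimes> x) = x"
    using assms by (simp_all flip: m_assoc)
  show "z \<otimes> (inv z \<otimes> x \<otimes> z) \<otimes> inv z = x" "inv z \<otimes> (z \<otimes> x \<otimes> inv z) \<otimes> z = x"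
    using assms * by (simp_all add: m_assoc)
qed

lemma conj_conj:
  assumes "z \<in> carrier G" "w \<in> carrier G" "x \<in> carrier G"
  shows "w \<otimes> (z \<otimes> x \<otimes> inv z) \<otimes> inv w = (w \<otimes> z) \<otimes> x \<otimes> inv (w \<otimes> z)"
  using assms by (simp add: m_assoc inv_mult_group)

lemma ord_conj:
  assumes "z \<in> carrier G" "x \<in> carrier G"
  shows "ord (z \<otimes> x \<otimes> inv z) = ord x"
proof -
  have "(z \<otimes> x \<otimes> inv z) [^] (i::nat) = \<one> \<longleftrightarrow> x [^] i = \<one>" for i
    using assms conj_inj[of z "x [^] i" \<one>] by (simp add: conj_pow)
  then show ?thesis using assms ord_unique[of "z \<otimes> x \<otimes> inv z"] by (simp add: pow_eq_id)
qed

definition centralizer_of :: "'a \<Rightarrow> 'a set" where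
  "centralizer_of c = {g \<in> carrier G. g \<otimes> c = c \<otimes> g}"

lemma subgroup_centralizer_of:
  assumes "c \<in> carrier G"
  shows "subgroup (centralizer_of c) G"
proof (rule subgroupI)
  fix a assume "a \<in> centralizer_of c"
  then have a: "a \<in> carrier G" "a \<otimes> c = c \<otimes> a" by (auto simp: centralizer_of_def)
  have "inv a \<otimes> c = inv a \<otimes> (c \<otimes> a) \<otimes> inv a" using a(1) assms by (simp add: m_assoc)
  also have "\<dots> = inv a \<otimes> (a \<otimes> c) \<otimes> inv a" using a(2) by simp
  also have "\<dots> = c \<otimes> inv a" using a(1) assms by (simp flip: m_assoc)
  finally show "inv a \<in> centralizer_of c" using a by (simp add: centralizer_of_def)
  fix b assume "b \<in> centralizer_of c"
  then have b: "b \<in> carrier G" "b \<otimes> c = c \<otimes> b" by (auto simp: centralizer_of_def)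
  have "a \<otimes> b \<otimes> c = (a \<otimes> c) \<otimes> b" using a(1) b assms by (simp add: m_assoc)
  also have "\<dots> = c \<otimes> (a \<otimes> b)" using a b(1) assms by (simp add: m_assoc)
  finally show "a \<otimes> b \<in> centralizer_of c" using a b by (simp add: centralizer_of_def)
qed (use assms in \<open>auto simp: centralizer_of_def\<close>)

lemma pow_commute:
  assumes "x \<in> carrier G" "y \<in> carrier G" "x \<otimes> y = y \<otimes> x"
  shows "x [^] (i::nat) \<otimes> y = y \<otimes> x [^] i"
  using assms
proof (induction i)
  case (Suc i)
  have "x [^] i \<otimes> x \<otimes> y = x [^] i \<otimes> (y \<otimes> x)" using Suc.prems by (simp only: m_assoc nat_pow_closed)
  also have "\<dots> = y \<otimes> x [^] i \<otimes> x" using Suc.prems Suc.IH[OF Suc.prems] by (simp flip: m_assoc)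
  finally show ?case using Suc.prems by (simp add: m_assoc)
qed simp

lemma ord_subgroup:
  assumes "subgroup H G" "x \<in> H"
  shows "group.ord (G\<lparr>carrier := H\<rparr>) x = ord x"
proof -
  interpret H: group "G\<lparr>carrier := H\<rparr>" by (rule subgroup_imp_group[OF assms(1)])
  have "x \<in> carrier G" by (rule subgroup.mem_carrier[OF assms])
  then have "x [^]\<^bsub>G\<lparr>carrier := H\<rparr>\<^esub> n = \<one>\<^bsub>G\<lparr>carrier := H\<rparr>\<^esub> \<longleftrightarrow> ord x dvd n" for n :: nat
    using pow_eq_id[of x n] nat_pow_consistent[of x n H] by simp
  then show ?thesis using assms(2) H.ord_unique[of x "ord x"] by simp
qed

text \<open>
  Right multiplication by \<open>a\<close> permutes the cosets of \<open>S\<close>, whose number is prime to \<open>q\<close>, so it fixes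
  some coset \<open>Sz\<close>, which means that \<open>z a z\<^sup>-\<^sup>1\<close> lies in \<open>S\<close>.
\<close>
lemma conj_into_Sylow:
  assumes q: "Factorial_Ring.prime (q::nat)" and fin: "finite (carrier G)"
    and S: "subgroup S G" "\<not> q dvd order G div card S"
    and a: "a \<in> carrier G" "a [^] (q ^ k) = \<one>"
  shows "\<exists>z\<in>carrier G. z \<otimes> a \<otimes> inv z \<in> S"
proof -
  let ?T = "rcosets S"
  let ?f = "\<lambda>C. C #> a"
  have Sc: "S \<subseteq> carrier G" using S subgroup.subset by blast
  have cS: "card S > 0" using subgroup.finite_imp_card_positive[OF S(1) fin] .
  have cT: "order G div card S = card ?T"
    using div_mult_self_is_m[OF cS, of "card ?T"] lagrange_finite[OF fin S(1)] by simp
  have sub: "C \<subseteq> carrier G" if "C \<in> ?T" for C using that S(1) rcosets_subset_PowG by blast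
  have iter: "(?f ^^ i) C = C #> a [^] i" if "C \<subseteq> carrier G" for C i
    using that a(1) by (induction i) (simp_all add: coset_mult_assoc coset_mult_one)
  have "card ?T mod q = card {C \<in> ?T. ?f C = C} mod q"
  proof (rule card_fixed_points_cong[OF q])
    show "finite ?T" using S(1) fin by (metis finite_Pow_iff finite_subset rcosets_subset_PowG)
    show "\<And>C. C \<in> ?T \<Longrightarrow> C #> a \<in> ?T"
      using a(1) Sc by (auto simp: RCOSETS_def coset_mult_assoc)
    show "\<And>C. C \<in> ?T \<Longrightarrow> (?f ^^ (q ^ k)) C = C"
      using iter sub a(2) coset_mult_one by simp
  qed
  moreover have "card ?T mod q \<noteq> 0" using S(2) cT by (metis mod_0_imp_dvd)
  ultimately have "{C \<in> ?T. ?f C = C} \<noteq> {}" by (metis card.empty mod_0)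
  then obtain C where "C \<in> ?T" "C #> a = C" by blast
  then obtain h where h: "h \<in> carrier G" "S #> h #> a = S #> h" by (auto simp: RCOSETS_def)
  then have "S #> (h \<otimes> a) = S #> h" using a Sc by (simp add: coset_mult_assoc)
  moreover have "h \<otimes> a \<in> S #> (h \<otimes> a)" using h a S(1) rcos_self by blast
  ultimately obtain s where s: "s \<in> S" "h \<otimes> a = s \<otimes> h" by (auto simp: r_coset_def)
  then have "h \<otimes> a \<otimes> inv h = s" using h a Sc by (metis inv_solve_right m_closed subsetD)
  then show ?thesis using s h by blast
qed

lemma root_count_conj:
  assumes "z \<in> carrier G" "x \<in> carrier G"
  shows "root_count G l (z \<otimes> x \<otimes> inv z) = root_count G l x"
proof -
  have "bij_betw (\<lambda>h. z \<otimes> h \<otimes> inv z) {h \<in> carrier G. h [^] l = x}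
     {h \<in> carrier G. h [^] l = z \<otimes> x \<otimes> inv z}"
  proof (rule bij_betw_byWitness[where f' = "\<lambda>h. inv z \<otimes> h \<otimes> z"])
    have "(inv z \<otimes> h \<otimes> z) [^] l = x" if "h \<in> carrier G" "h [^] l = z \<otimes> x \<otimes> inv z" for h
      using conj_pow[of "inv z" h l] assms that conj_inverse(2)[of z x] by simp
    then show "(\<lambda>h. inv z \<otimes> h \<otimes> z) ` {h \<in> carrier G. h [^] l = z \<otimes> x \<otimes> inv z}
       \<subseteq> {h \<in> carrier G. h [^] l = x}" using assms by auto
  qed (use assms conj_inverse conj_pow in auto)
  from bij_betw_same_card[OF this] show ?thesis unfolding root_count_def by (rule sym)
qed

text \<open>
  The map \<open>h \<mapsto> h\<^sup>j\<close> is a bijection of the group that takes roots of \<open>x\<close> to roots of \<open>x\<^sup>j\<close>.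
\<close>
lemma root_count_pow:
  assumes "finite (carrier G)" "x \<in> carrier G" "coprime j (order G)"
  shows "root_count G l (x [^] j) = root_count G l x"
proof -
  obtain j' where j': "j * j' mod order G = 1 mod order G"
  proof (cases "j = 0")
    case True
    then show ?thesis using assms(3) that[of 0] by simp
  next
    case False
    then obtain a b where "j * a = order G * b + 1"
      using bezout_nat[of j "order G"] assms(3) by (auto simp: coprime_iff_gcd_eq_1)
    then have "j * a mod order G = 1 mod order G" by (simp only: mod_mult_self4)
    then show ?thesis by (rule that)
  qed
  have pull: "(h [^] j) [^] j' = h" "(h [^] j') [^] j = h" if h: "h \<in> carrier G" for h
  proof -
    have "h [^] (j * j') = h [^] (1::nat)"
      unfolding pow_eq_iff_mod[OF h]
      using arg_cong[OF j', of "\<lambda>i. i mod ord h"] ord_dvd_group_order[OF h]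
      by (simp only: mod_mod_cancel)
    then show "(h [^] j) [^] j' = h" "(h [^] j') [^] j = h"
      using h nat_pow_pow[OF h, of j j'] nat_pow_pow[OF h, of j' j] by (simp_all add: mult.commute)
  qed
  have swap: "(h [^] i) [^] k = (h [^] k) [^] i" if "h \<in> carrier G" for h and i k :: nat
    using that by (simp add: nat_pow_pow mult.commute)
  have "bij_betw (\<lambda>h. h [^] j) {h \<in> carrier G. h [^] l = x} {h \<in> carrier G. h [^] l = x [^] j}"
  proof (rule bij_betw_byWitness[where f' = "\<lambda>h. h [^] j'"])
    show "(\<lambda>h. h [^] j) ` {h \<in> carrier G. h [^] l = x} \<subseteq> {h \<in> carrier G. h [^] l = x [^] j}"
      using swap[of _ j l] by auto
    have "(h [^] j') [^] l = x" if "h \<in> carrier G" "h [^] l = x [^] j" for h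
      using swap[OF that(1), of j' l] that(2) pull(1)[OF assms(2)] by simp
    then show "(\<lambda>h. h [^] j') ` {h \<in> carrier G. h [^] l = x [^] j} \<subseteq> {h \<in> carrier G. h [^] l = x}"
      by auto
  qed (use pull in auto)
  from bij_betw_same_card[OF this] show ?thesis unfolding root_count_def by (rule sym)
qed

lemma root_count_eq_if_conj_cyclic:
  assumes fin: "finite (carrier G)" and xy: "x \<in> carrier G" "y \<in> carrier G" "ord x = ord y"
    and z: "z \<in> carrier G" "z \<otimes> x \<otimes> inv z = y [^] (k::nat)"
  shows "root_count G l x = root_count G l y"
proof -
  have "ord (y [^] k) = ord y" using ord_conj[OF z(1) xy(1)] z xy by simp
  then have "coprime k (ord y)" using pow_ord_eq_ord_iff[OF fin xy(2)] by simp
  then obtain t where t: "coprime (k + ord y * t) (order G)"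
    using coprime_shift_exists fin order_gt_0_iff_finite by blast
  have "root_count G l x = root_count G l (y [^] k)"
    using root_count_conj[OF z(1) xy(1), of l] z(2) by simp
  also have "y [^] k = y [^] (k + ord y * t)" using xy by (simp add: pow_eq_iff_mod)
  also have "root_count G l \<dots> = root_count G l y" by (rule root_count_pow[OF fin xy(2) t])
  finally show ?thesis .
qed

end

section \<open>Cyclic subgroups that Sylow theory forces to be conjugate\<close>

context group
begin

text \<open>
  Among the \<open>q + 1\<close> cosets \<open>B, Ba, \<dots>, Ba\<^sup>q\<close> two coincide, so \<open>a\<^sup>d\<close> lies in \<open>B\<close> for some \<open>d\<close> with
  \<open>1 \<le> d \<le> q\<close>. If \<open>d < q\<close>, then \<open>d\<close> is invertible modulo the order of \<open>a\<close> and even \<open>a\<close> lies in \<open>B\<close>.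
\<close>
lemma prime_pow_in_subgroup_of_small_index:
  assumes q: "Factorial_Ring.prime (q::nat)" and fin: "finite (carrier G)"
    and S: "subgroup S G" and B: "subgroup B G" "B \<subseteq> S" "card S \<le> q * card B"
    and a: "a \<in> S" "a [^] (q ^ k) = \<one>"
  shows "a [^] q \<in> B"
proof -
  have ac: "a \<in> carrier G" using a(1) subgroup.mem_carrier[OF S] by simp
  have Bc: "b \<in> carrier G" if "b \<in> B" for b using that subgroup.mem_carrier[OF B(1)] by simp
  have finS: "finite S" using fin subgroup.subset[OF S] finite_subset by blast
  have cB: "card B > 0" using subgroup.finite_imp_card_positive[OF B(1) fin] .
  have pow_in: "a [^] (i::nat) \<in> S" for i
    using subgroup.one_closed[OF S] subgroup.m_closed[OF S] a(1) by (induction i) auto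
  let ?D = "{..q} \<times> B"
  let ?f = "\<lambda>(i::nat, b). b \<otimes> a [^] i"
  have "?f ` ?D \<subseteq> S" using pow_in B(2) subgroup.m_closed[OF S] by auto
  then have "card (?f ` ?D) \<le> card S" using finS by (simp add: card_mono)
  also have "\<dots> < card ?D" using B(3) cB by (simp add: card_cartesian_product)
  finally have "\<not> inj_on ?f ?D" using pigeonhole by blast
  then obtain i j b b' where ij: "i \<le> q" "j \<le> q" "b \<in> B" "b' \<in> B" "(i, b) \<noteq> (j, b')"
    and eq: "b \<otimes> a [^] i = b' \<otimes> a [^] j" unfolding inj_on_def by auto
  have key: "\<exists>d. 0 < d \<and> d \<le> q \<and> a [^] d \<in> B"
    if h: "i < j" "j \<le> q" "b \<in> B" "b' \<in> B" "b \<otimes> a [^] i = b' \<otimes> a [^] j" for i j b b'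
  proof -
    have "b' \<otimes> a [^] j = b' \<otimes> a [^] (j - i) \<otimes> a [^] i"
      using h Bc ac by (simp add: m_assoc nat_pow_mult)
    then have "b = b' \<otimes> a [^] (j - i)" using h Bc ac by (metis m_closed nat_pow_closed right_cancel)
    then have "a [^] (j - i) = inv b' \<otimes> b" using h Bc ac by (simp flip: m_assoc)
    then have "a [^] (j - i) \<in> B"
      using h subgroup.m_closed[OF B(1)] subgroup.m_inv_closed[OF B(1)] by simp
    then show ?thesis using h by (intro exI[of _ "j - i"]) auto
  qed
  have "i \<noteq> j"
  proof
    assume "i = j"
    then have "b = b'" using eq ij Bc ac by simp
    then show False using ij \<open>i = j\<close> by simp
  qed
  then consider "i < j" | "j < i" by linarith
  then obtain d where d: "0 < d" "d \<le> q" "a [^] d \<in> B"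
    using key[OF _ ij(2,3,4) eq] key[OF _ ij(1,4,3) eq[symmetric]] by cases blast+
  have powB: "c [^] (i::nat) \<in> B" if "c \<in> B" for c i
    using subgroup.one_closed[OF B(1)] subgroup.m_closed[OF B(1)] that by (induction i) auto
  show ?thesis
  proof (cases "d = q")
    case True
    then show ?thesis using d by simp
  next
    case False
    then have "\<not> q dvd d" using d by (intro nat_dvd_not_less) auto
    then have "coprime d (q ^ k)" using q prime_imp_coprime coprime_commute coprime_power_right_iff by blast
    then obtain e f where "d * e = q ^ k * f + 1"
      using bezout_nat[of d "q ^ k"] d by (auto simp: coprime_iff_gcd_eq_1)
    then have "(a [^] d) [^] e = (a [^] (q ^ k)) [^] f \<otimes> a" using ac by (simp add: nat_pow_pow)
    then have "a \<in> B" using powB[OF d(3), of e] a ac by simp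
    then show ?thesis by (rule powB)
  qed
qed

lemma ord_prime_root:
  assumes "Factorial_Ring.prime (q::nat)" "a \<in> carrier G" "a [^] q = x" "q dvd ord x"
  shows "ord a = q * ord x"
proof -
  have q0: "q \<noteq> 0" using assms(1) by auto
  have x: "ord x = ord a div gcd (ord a) q" using ord_pow_gen[OF assms(2), of q] assms(3) q0 by simp
  have "q dvd ord a"
    using assms(4) x by (metis div_dvd_iff_mult dvd_mult_left dvd_trans gcd_dvd1 dvd_div_mult_self dvd_mult2)
  then show ?thesis using x q0 by (simp add: gcd_nat.absorb2)
qed

text \<open>
  Here \<open>x\<^sup>m\<close> and \<open>y\<^sup>m\<close> generate the \<open>q\<close>-parts of the cyclic groups of \<open>x\<close> and \<open>y\<close>. In the first case
  \<open>\<langle>y\<^sup>m\<rangle>\<close> is a Sylow subgroup. In the second, conjugate the \<open>q\<close>-parts of the \<open>q\<close>-th roots \<open>a\<close> and \<open>b\<close>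
  into one Sylow subgroup. There the part of \<open>b\<close> generates a subgroup of index at most \<open>q\<close>, so that
  subgroup contains the \<open>q\<close>-th power of the part of \<open>a\<close>; and a cyclic \<open>q\<close>-group has only one
  subgroup of each order.
\<close>
lemma primary_part_conj:
  assumes fin: "finite (carrier G)" and q: "Factorial_Ring.prime (q::nat)"
    and xy: "x \<in> carrier G" "y \<in> carrier G" "ord x = n" "ord y = n"
    and n: "n = q ^ c * m" "\<not> q dvd m"
    and hyp: "multiplicity q (order G) \<le> c \<or>
      (0 < c \<and> multiplicity q (order G) \<le> c + 2 \<and> (\<exists>a\<in>carrier G. a [^] q = x) \<and> (\<exists>b\<in>carrier G. b [^] q = y))"
  shows "\<exists>z\<in>carrier G. \<exists>k::nat. z \<otimes> x [^] m \<otimes> inv z = (y [^] m) [^] k"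
proof -
  let ?e = "multiplicity q (order G)"
  have o0: "order G \<noteq> 0" using fin order_gt_0_iff_finite by simp
  have q1: "q > 1" using q prime_gt_1_nat by blast
  have n0: "n > 0" using ord_ge_1[OF fin xy(1)] xy by simp
  then have m0: "m > 0" using n by (cases m) auto
  obtain M where M: "order G = q ^ ?e * M" "\<not> q dvd M"
    using multiplicity_decompose'[of "order G" q] o0 q1 by (auto simp: mult.commute)
  have "n dvd order G" using ord_dvd_group_order[OF xy(1)] xy by simp
  then have "q ^ c dvd order G" using n by (meson dvd_mult_left)
  then have ce: "c \<le> ?e" using o0 q1 by (simp add: power_dvd_iff_le_multiplicity)
  have ordm: "ord (x [^] m) = q ^ c" "ord (y [^] m) = q ^ c"
    using ord_pow[of x m] ord_pow[of y m] xy n m0 by simp_all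
  have index: "order G div q ^ ?e = M"
    using M(1) q1 by (metis nonzero_mult_div_cancel_left power_not_zero not_one_less_zero)
  from hyp show ?thesis
  proof
    assume "?e \<le> c"
    then have e: "?e = c" using ce by simp
    let ?S = "generate G {y [^] m}"
    have S: "subgroup ?S G" using xy by (intro generate_is_subgroup) auto
    have "card ?S = q ^ c" using generate_pow_card[of "y [^] m"] xy ordm by simp
    then have "\<not> q dvd order G div card ?S" using index e M(2) by simp
    moreover have "(x [^] m) [^] (q ^ c) = \<one>" using ordm(1) xy(1) pow_eq_id[of "x [^] m"] by simp
    ultimately obtain z where "z \<in> carrier G" "z \<otimes> x [^] m \<otimes> inv z \<in> ?S"
      using conj_into_Sylow[OF q fin S] xy(1) nat_pow_closed by blast
    then show ?thesis using generate_singleton_eq_powers[OF fin, of "y [^] m"] xy by auto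
  next
    assume h: "0 < c \<and> ?e \<le> c + 2 \<and> (\<exists>a\<in>carrier G. a [^] q = x) \<and> (\<exists>b\<in>carrier G. b [^] q = y)"
    then obtain a b where a: "a \<in> carrier G" "a [^] q = x" and b: "b \<in> carrier G" "b [^] q = y" by blast
    have qn: "q dvd n" using h n by simp
    have orda: "ord a = q * n" using ord_prime_root[OF q a] qn xy by simp
    have ordb: "ord b = q * n" using ord_prime_root[OF q b] qn xy by simp
    have ordam: "ord (a [^] m) = q ^ (c + 1)" "ord (b [^] m) = q ^ (c + 1)"
      using ord_pow[of a m] ord_pow[of b m] a b orda ordb n m0 by simp_all
    obtain S where S: "subgroup S G" "card S = q ^ ?e"
      using sylow_thm[OF q is_group M(1) fin] by blast
    have ndvd: "\<not> q dvd order G div card S" using index M(2) S by simp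
    have pa: "(a [^] m) [^] (q ^ (c + 1)) = \<one>" "(b [^] m) [^] (q ^ (c + 1)) = \<one>"
      using ordam a b pow_eq_id[of "a [^] m"] pow_eq_id[of "b [^] m"] by simp_all
    obtain z1 where z1: "z1 \<in> carrier G" "z1 \<otimes> a [^] m \<otimes> inv z1 \<in> S"
      using conj_into_Sylow[OF q fin S(1) ndvd _ pa(1)] a by auto
    obtain z2 where z2: "z2 \<in> carrier G" "z2 \<otimes> b [^] m \<otimes> inv z2 \<in> S"
      using conj_into_Sylow[OF q fin S(1) ndvd _ pa(2)] b by auto
    let ?a = "z1 \<otimes> a [^] m \<otimes> inv z1" and ?b = "z2 \<otimes> b [^] m \<otimes> inv z2"
    have ab: "?a \<in> carrier G" "?b \<in> carrier G" using z1 z2 a b by simp_all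
    let ?B = "generate G {?b}"
    have "ord ?b = q ^ (c + 1)" using ord_conj[OF z2(1), of "b [^] m"] b ordam by simp
    then have cB: "card ?B = q ^ (c + 1)" using generate_pow_card[OF ab(2)] by simp
    have BS: "?B \<subseteq> S" using generate_subgroup_incl[OF _ S(1), of "{?b}"] z2 by simp
    have "card S \<le> q * card ?B" using S(2) cB h q1 power_increasing[of ?e "c + 2" q] by simp
    moreover have "?a [^] (q ^ (c + 1)) = \<one>"
      using conj_pow[OF z1(1), of "a [^] m" "q ^ (c + 1)"] pa a z1 by simp
    ultimately have "?a [^] q \<in> ?B"
      using prime_pow_in_subgroup_of_small_index[OF q fin S(1) _ BS _ z1(2)] generate_is_subgroup[of "{?b}"] ab
      by blast
    then obtain i :: nat where i: "?a [^] q = ?b [^] i" using generate_singleton_eq_powers[OF fin ab(2)] by auto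
    have am: "(a [^] m) [^] q = x [^] m" "(b [^] m) [^] q = y [^] m"
      using nat_pow_pow[of a m q] nat_pow_pow[of a q m] nat_pow_pow[of b m q] nat_pow_pow[of b q m] a b
      by (simp_all add: mult.commute)
    have aq: "?a [^] q = z1 \<otimes> x [^] m \<otimes> inv z1" using conj_pow[OF z1(1), of "a [^] m" q] a am by simp
    have bq: "?b [^] q = z2 \<otimes> y [^] m \<otimes> inv z2" using conj_pow[OF z2(1), of "b [^] m" q] b am by simp
    have "(?a [^] q) [^] (q ^ c) = \<one>"
      using \<open>?a [^] (q ^ (c + 1)) = \<one>\<close> nat_pow_pow[OF ab(1), of q "q ^ c"] by simp
    then have "?b [^] (i * q ^ c) = \<one>" using i nat_pow_pow[OF ab(2), of i "q ^ c"] by simp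
    then have "q ^ (c + 1) dvd i * q ^ c" using pow_eq_id[OF ab(2)] \<open>ord ?b = q ^ (c + 1)\<close> by simp
    then have "q dvd i" using q1 by simp
    then obtain i' where i': "i = q * i'" by blast
    have "z1 \<otimes> x [^] m \<otimes> inv z1 = (?b [^] q) [^] i'"
      using i i' aq nat_pow_pow[OF ab(2), of q i'] by simp
    also have "\<dots> = z2 \<otimes> (y [^] m) [^] i' \<otimes> inv z2"
      using bq conj_pow[OF z2(1), of "y [^] m" i'] xy by simp
    finally have "inv z2 \<otimes> (z1 \<otimes> x [^] m \<otimes> inv z1) \<otimes> z2 = (y [^] m) [^] i'"
      using conj_inverse(2)[OF z2(1), of "(y [^] m) [^] i'"] xy by simp
    then have "(inv z2 \<otimes> z1) \<otimes> x [^] m \<otimes> inv (inv z2 \<otimes> z1) = (y [^] m) [^] i'"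
      using conj_conj[OF z1(1) inv_closed[OF z2(1)], of "x [^] m"] xy z2 by simp
    then show ?thesis using z1 z2 by (meson inv_closed m_closed)
  qed
qed

text \<open>
  Induction over the divisors \<open>d\<close> of the common order \<open>n\<close> with \<open>d\<close> prime to \<open>n / d\<close>, adding one prime at a time: once
  the \<open>d\<close>-part of \<open>x\<close> is a power of \<open>y\<close>, the next primary part is moved by an element of the
  centraliser of this \<open>d\<close>-part, where the arithmetic hypotheses and the roots survive.
\<close>
lemma conj_into_cyclic_subgroup:
  assumes fin: "finite (carrier G)" and x: "x \<in> carrier G" and y: "y \<in> carrier G"
    and ordxy: "ord x = ord y"
    and hyp: "\<And>q. Factorial_Ring.prime (q::nat) \<Longrightarrow> q dvd ord x \<Longrightarrow>
      multiplicity q (order G) \<le> multiplicity q (ord x) \<or>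
      (multiplicity q (order G) \<le> multiplicity q (ord x) + 2 \<and>
       (\<exists>a\<in>carrier G. a [^] q = x) \<and> (\<exists>b\<in>carrier G. b [^] q = y))"
  shows "\<exists>z\<in>carrier G. \<exists>k::nat. z \<otimes> x \<otimes> inv z = y [^] k"
proof -
  define n where "n = ord x"
  define Y where "Y = generate G {y}"
  have Y: "subgroup Y G" unfolding Y_def using y by (intro generate_is_subgroup) auto
  have Yr: "Y = range (\<lambda>k::nat. y [^] k)" unfolding Y_def by (rule generate_singleton_eq_powers[OF fin y])
  have n0: "n > 0" using ord_ge_1[OF fin x] n_def by simp
  have o0: "order G \<noteq> 0" using fin order_gt_0_iff_finite by simp
  have "\<exists>z\<in>carrier G. z \<otimes> x [^] (n div d) \<otimes> inv z \<in> Y" if "d dvd n" "coprime d (n div d)" for d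
    using that
  proof (induction d rule: less_induct)
    case (less d)
    have d0: "d > 0" using less.prems(1) n0 by (cases d) auto
    show ?case
    proof (cases "d = 1")
      case True
      have "x [^] n = \<one>" using x n_def by simp
      then show ?thesis using True subgroup.one_closed[OF Y] by (intro bexI[of _ \<one>]) simp_all
    next
      case False
      then obtain q where q: "Factorial_Ring.prime q" "q dvd d" using prime_factor_nat by blast
      define r where "r = n div d"
      have nr: "n = d * r" unfolding r_def using less.prems(1) by simp
      define c where "c = multiplicity q d"
      have q1: "q > 1" using q(1) prime_gt_1_nat by blast
      obtain d' where d': "d = q ^ c * d'" "\<not> q dvd d'"
        unfolding c_def using multiplicity_decompose'[of d q] d0 q1 by (auto simp: mult.commute)
      have c0: "0 < c" using q(2) d' by (cases c) auto
      have qr: "\<not> q dvd r"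
      proof
        assume "q dvd r"
        then have "q dvd gcd d r" using q(2) by simp
        then show False using less.prems(2) q1 unfolding r_def by simp
      qed
      have d'0: "d' > 0" using d0 d' by (cases d') auto
      have cop: "coprime (q ^ c) d'" using q(1) d'(2) prime_imp_coprime coprime_power_left_iff by blast
      have "coprime d r" using less.prems(2) r_def by simp
      then have "coprime d' r" using d'(1) by simp
      then have copd': "coprime d' (q ^ c * r)" using cop by (simp add: coprime_commute)
      have nd': "n = d' * (q ^ c * r)" using nr d' by simp
      then have nd'r: "n div d' = q ^ c * r" using d'0 by simp
      have "d' < d" using d'(1) d'0 one_less_power[OF q1 c0] by simp
      then obtain z1 where z1: "z1 \<in> carrier G" "z1 \<otimes> x [^] (q ^ c * r) \<otimes> inv z1 \<in> Y"
        using less.IH[of d'] nd' nd'r copd' by auto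
      define m where "m = d' * r"
      have nm: "n = q ^ c * m" unfolding m_def using nr d' by simp
      have qm: "\<not> q dvd m" unfolding m_def using qr d'(2) q(1) prime_dvd_mult_iff by blast
      have mc: "multiplicity q n = c"
        using nm qm q1 n0 by (simp add: multiplicity_eqI)
      define x1 where "x1 = z1 \<otimes> x \<otimes> inv z1"
      have x1: "x1 \<in> carrier G" "ord x1 = n" unfolding x1_def using z1 x ord_conj n_def by simp_all
      \<comment> \<open>The part of \<open>x\<close> already moved into \<open>Y\<close> is kept in place by conjugating within its centraliser.\<close>
      define h where "h = x1 [^] (q ^ c * r)"
      have hY: "h \<in> Y" unfolding h_def x1_def using z1 conj_pow[OF z1(1) x] by simp
      then obtain k1 :: nat where k1: "h = y [^] k1" using Yr by auto
      have hc: "h \<in> carrier G" unfolding h_def using x1 by simp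
      define C where "C = centralizer_of h"
      have C: "subgroup C G" unfolding C_def by (rule subgroup_centralizer_of[OF hc])
      have powC: "g \<in> C" if "g \<in> carrier G" "h = g [^] (i::nat)" for g i
        unfolding C_def centralizer_of_def using that pow_commute[of g g i] by simp
      have xC: "x1 \<in> C" using powC x1 h_def by blast
      have yC: "y \<in> C" using powC y k1 by blast
      interpret CG: group "G\<lparr>carrier := C\<rparr>" by (rule subgroup_imp_group[OF C])
      have oC: "order (G\<lparr>carrier := C\<rparr>) = card C" by (simp add: order_def)
      have "card C dvd order G" using lagrange[OF C] by (metis dvd_triv_right)
      then have mle: "multiplicity q (card C) \<le> multiplicity q (order G)"
        using o0 by (intro dvd_imp_multiplicity_le) auto
      have qn: "q dvd ord x" using q(2) nr n_def by simp
      have "\<exists>z\<in>carrier (G\<lparr>carrier := C\<rparr>). \<exists>k::nat.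
        z \<otimes>\<^bsub>G\<lparr>carrier := C\<rparr>\<^esub> x1 [^]\<^bsub>G\<lparr>carrier := C\<rparr>\<^esub> m \<otimes>\<^bsub>G\<lparr>carrier := C\<rparr>\<^esub> inv\<^bsub>G\<lparr>carrier := C\<rparr>\<^esub> z
          = (y [^]\<^bsub>G\<lparr>carrier := C\<rparr>\<^esub> m) [^]\<^bsub>G\<lparr>carrier := C\<rparr>\<^esub> k"
      proof (rule CG.primary_part_conj[OF _ q(1) _ _ _ _ nm qm])
        show "finite (carrier (G\<lparr>carrier := C\<rparr>))"
          using fin subgroup.subset[OF C] finite_subset by simp blast
        show "x1 \<in> carrier (G\<lparr>carrier := C\<rparr>)" "y \<in> carrier (G\<lparr>carrier := C\<rparr>)" using xC yC by simp_all
        show "CG.ord x1 = n" "CG.ord y = n"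
          using ord_subgroup[OF C] xC yC x1 ordxy n_def by simp_all
        show "multiplicity q (order (G\<lparr>carrier := C\<rparr>)) \<le> c \<or>
          (0 < c \<and> multiplicity q (order (G\<lparr>carrier := C\<rparr>)) \<le> c + 2 \<and>
          (\<exists>a\<in>carrier (G\<lparr>carrier := C\<rparr>). a [^]\<^bsub>G\<lparr>carrier := C\<rparr>\<^esub> q = x1) \<and>
          (\<exists>b\<in>carrier (G\<lparr>carrier := C\<rparr>). b [^]\<^bsub>G\<lparr>carrier := C\<rparr>\<^esub> q = y))"
          using hyp[OF q(1) qn]
        proof
          assume "multiplicity q (order G) \<le> multiplicity q (ord x)"
          then show ?thesis using mle mc n_def oC by simp
        next
          assume h2: "multiplicity q (order G) \<le> multiplicity q (ord x) + 2 \<and>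
            (\<exists>a\<in>carrier G. a [^] q = x) \<and> (\<exists>b\<in>carrier G. b [^] q = y)"
          then obtain a b where ab: "a \<in> carrier G" "a [^] q = x" "b \<in> carrier G" "b [^] q = y" by blast
          let ?a = "z1 \<otimes> a \<otimes> inv z1"
          have ac: "?a \<in> carrier G" "?a [^] q = x1" unfolding x1_def using ab z1 conj_pow by simp_all
          have "h = ?a [^] (q * (q ^ c * r))" unfolding h_def using ac(2) nat_pow_pow[OF ac(1), of q "q ^ c * r"] by simp
          then have aC: "?a \<in> C" using powC ac by blast
          have "h = b [^] (q * k1)" using k1 ab(4) nat_pow_pow[OF ab(3), of q k1] by simp
          then have bC: "b \<in> C" using powC ab by blast
          show ?thesis using aC bC ac ab h2 mle mc n_def oC c0
            by (auto simp: nat_pow_consistent[of _ _ C, symmetric])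
        qed
      qed
      then obtain z2 k2 where z2: "z2 \<in> C" "z2 \<otimes> x1 [^] m \<otimes> inv z2 = (y [^] m) [^] (k2::nat)"
        using m_inv_consistent[OF C] by (auto simp: nat_pow_consistent[of _ _ C, symmetric])
      have z2c: "z2 \<in> carrier G" using z2 subgroup.mem_carrier[OF C] by blast
      define z where "z = z2 \<otimes> z1"
      define g where "g = z2 \<otimes> x1 \<otimes> inv z2"
      have zc: "z \<in> carrier G" and gz: "g = z \<otimes> x \<otimes> inv z"
        unfolding z_def g_def x1_def using z1 z2c x conj_conj[OF z1(1) z2c x] by simp_all
      have gc: "g \<in> carrier G" unfolding gz using zc x by simp
      have "g [^] m = (y [^] m) [^] k2" unfolding g_def using conj_pow[OF z2c x1(1)] z2 by simp
      then have gm: "g [^] m \<in> Y" using Yr y by (simp add: nat_pow_pow)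
      have "g [^] (q ^ c * r) = z2 \<otimes> h \<otimes> inv z2"
        unfolding g_def h_def using conj_pow[OF z2c x1(1)] by simp
      also have "\<dots> = h \<otimes> z2 \<otimes> inv z2" using z2(1) by (simp add: C_def centralizer_of_def)
      also have "\<dots> = h" using hc z2c by (simp add: m_assoc)
      finally have gq: "g [^] (q ^ c * r) \<in> Y" using hY by simp
      have powY: "w [^] (i::nat) \<in> Y" if "w \<in> Y" for w i
        using subgroup.one_closed[OF Y] subgroup.m_closed[OF Y] that by (induction i) auto
      obtain s t where st: "q ^ c * s = d' * t + 1"
        using bezout_nat[of "q ^ c" d'] q1 cop by (auto simp: coprime_iff_gcd_eq_1)
      have "q ^ c * r * s = m * t + r" unfolding m_def
        using arg_cong[OF st, of "\<lambda>i. i * r"] by (simp add: algebra_simps)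
      then have "(g [^] (q ^ c * r)) [^] s = (g [^] m) [^] t \<otimes> g [^] r"
        using gc by (simp add: nat_pow_pow nat_pow_mult)
      then have "g [^] r = inv ((g [^] m) [^] t) \<otimes> (g [^] (q ^ c * r)) [^] s"
        using gc by (simp add: inv_solve_left)
      also have "\<dots> \<in> Y"
        using powY[OF gm, of t] powY[OF gq, of s] subgroup.m_closed[OF Y] subgroup.m_inv_closed[OF Y] by simp
      finally have "z \<otimes> x [^] r \<otimes> inv z \<in> Y" using gz conj_pow[OF zc x] by simp
      then show ?thesis using zc r_def by blast
    qed
  qed
  from this[of n] obtain z where z: "z \<in> carrier G" "z \<otimes> x [^] (n div n) \<otimes> inv z \<in> Y" using n0 by auto
  then have "z \<otimes> x \<otimes> inv z \<in> range (\<lambda>k::nat. y [^] k)" using n0 x Yr by simp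
  then show ?thesis using z(1) by auto
qed

end

section \<open>Roots as commuting pairs and the passage to a central quotient\<close>

lemma ex_less_if_sum_less:
  fixes f :: "'x \<Rightarrow> nat" and g :: "'y \<Rightarrow> nat"
  assumes "finite A" "finite B" "card A = card B" "sum f A < sum g B"
  shows "\<exists>a\<in>A. \<exists>b\<in>B. f a < g b"
proof (rule ccontr)
  assume "\<not> ?thesis"
  then have le: "g b \<le> f a" if "a \<in> A" "b \<in> B" for a b using that by (meson not_le)
  have "A \<noteq> {}" using assms by auto
  then obtain a where a: "a \<in> A" "f a = Min (f ` A)"
    using assms(1) by (metis (no_types, lifting) Min_in finite_imageI image_iff image_is_empty)
  have "sum g B \<le> card B * f a" using sum_bounded_above[of B g "f a"] le[OF a(1)] by simp
  also have "\<dots> \<le> sum f A"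
    using sum_bounded_below[of A "f a" f] a assms(1,3) by simp
  finally show False using assms(4) by simp
qed

context group
begin

abbreviation roots :: "nat \<Rightarrow> 'a \<Rightarrow> 'a set" where
  "roots l g \<equiv> {h \<in> carrier G. h [^] l = g}"

lemma commute_inv_pow:
  assumes "u \<in> carrier G" "v \<in> carrier G" "u \<otimes> v = v \<otimes> u"
  shows "u \<otimes> inv (v [^] (k::nat)) = inv (v [^] k) \<otimes> u"
proof -
  have "v [^] k \<in> centralizer_of u"
    using pow_commute[OF assms(2,1) assms(3)[symmetric], of k] assms by (simp add: centralizer_of_def)
  then have "inv (v [^] k) \<in> centralizer_of u"
    using subgroup.m_inv_closed[OF subgroup_centralizer_of[OF assms(1)]] by blast
  then show ?thesis by (simp add: centralizer_of_def)
qed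

text \<open>
  With \<open>p = 2k + 1\<close>, a root \<open>h\<close> is recovered from \<open>v = h\<^sup>2\<close> and \<open>u = h\<^sup>p\<close> as \<open>u v\<^sup>-\<^sup>k\<close>, and this formula
  turns each commuting pair of roots into a root of degree \<open>2p\<close>.
\<close>
lemma root_count_double:
  assumes fin: "finite (carrier G)" and p: "p = 2 * k + 1"
  shows "root_count G (2 * p) x =
    (\<Sum>v\<in>roots p x. card {u \<in> roots 2 x. u \<otimes> v = v \<otimes> u})"
proof -
  let ?P = "SIGMA v:roots p x. {u \<in> roots 2 x. u \<otimes> v = v \<otimes> u}"
  have "bij_betw (\<lambda>h. (h [^] (2::nat), h [^] p)) (roots (2 * p) x) ?P"
  proof (rule bij_betw_byWitness[where f' = "\<lambda>(v, u). u \<otimes> inv (v [^] k)"])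
    show "\<forall>h\<in>roots (2 * p) x. (case (h [^] (2::nat), h [^] p) of (v, u) \<Rightarrow> u \<otimes> inv (v [^] k)) = h"
    proof
      fix h assume "h \<in> roots (2 * p) x"
      then have h: "h \<in> carrier G" by simp
      have "h [^] p = h \<otimes> (h [^] (2::nat)) [^] k"
        using h p nat_pow_Suc2[OF h, of "2 * k"] by (simp add: nat_pow_pow)
      then show "(case (h [^] (2::nat), h [^] p) of (v, u) \<Rightarrow> u \<otimes> inv (v [^] k)) = h"
        using h by (simp add: m_assoc)
    qed
    have inv_pair: "(u \<otimes> inv (v [^] k)) [^] (2::nat) = v \<and> (u \<otimes> inv (v [^] k)) [^] p = u"
      if uv: "u \<in> carrier G" "v \<in> carrier G" "u [^] (2::nat) = x" "v [^] p = x" "u \<otimes> v = v \<otimes> u" for u v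
    proof -
      let ?w = "inv (v [^] k)"
      have xc: "x \<in> carrier G" using uv by auto
      have w: "?w \<in> carrier G" "u \<otimes> ?w = ?w \<otimes> u" using uv commute_inv_pow by simp_all
      have "(u \<otimes> ?w) [^] (2::nat) = x \<otimes> ?w [^] (2::nat)" using pow_mult_distrib[OF w(2) uv(1) w(1)] uv by simp
      also have "?w [^] (2::nat) = inv (v [^] (2 * k))"
        using nat_pow_inv[of "v [^] k" 2] uv by (simp add: nat_pow_pow mult.commute)
      also have "x = v \<otimes> v [^] (2 * k)" using uv p nat_pow_Suc2[OF uv(2), of "2 * k"] by simp
      also have "v \<otimes> v [^] (2 * k) \<otimes> inv (v [^] (2 * k)) = v" using uv by (simp add: m_assoc)
      finally have 1: "(u \<otimes> ?w) [^] (2::nat) = v" .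
      have "(u \<otimes> ?w) [^] p = u [^] p \<otimes> ?w [^] p" by (rule pow_mult_distrib[OF w(2) uv(1) w(1)])
      also have "?w [^] p = inv (x [^] k)"
        using nat_pow_inv[of "v [^] k" p] uv nat_pow_pow[OF uv(2), of k p] nat_pow_pow[OF uv(2), of p k]
        by (simp add: mult.commute)
      also have "u [^] p = u \<otimes> x [^] k"
        using nat_pow_Suc2[OF uv(1), of "2 * k"] nat_pow_pow[OF uv(1), of 2 k] p uv by simp
      also have "u \<otimes> x [^] k \<otimes> inv (x [^] k) = u" using uv xc by (simp add: m_assoc)
      finally show ?thesis using 1 by simp
    qed
    then show "\<forall>a\<in>?P. (\<lambda>h. (h [^] (2::nat), h [^] p)) (case a of (v, u) \<Rightarrow> u \<otimes> inv (v [^] k)) = a"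
      by auto
    have "(h [^] (2::nat)) [^] p = x" "(h [^] p) [^] (2::nat) = x"
      "h [^] p \<otimes> h [^] (2::nat) = h [^] (2::nat) \<otimes> h [^] p"
      if "h \<in> carrier G" "h [^] (2 * p) = x" for h
      using that nat_pow_pow[OF that(1), of 2 p] nat_pow_pow[OF that(1), of p 2]
        nat_pow_comm[OF that(1), of p 2] by (simp_all add: mult.commute)
    then show "(\<lambda>h. (h [^] (2::nat), h [^] p)) ` roots (2 * p) x \<subseteq> ?P" by auto
    have "(u \<otimes> inv (v [^] k)) [^] (2 * p) = x"
      if uv: "u \<in> carrier G" "v \<in> carrier G" "u [^] (2::nat) = x" "v [^] p = x" "u \<otimes> v = v \<otimes> u" for u v
      using inv_pair[OF uv] uv nat_pow_pow[of "u \<otimes> inv (v [^] k)" 2 p] by simp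
    then show "(\<lambda>(v, u). u \<otimes> inv (v [^] k)) ` ?P \<subseteq> roots (2 * p) x" by auto
  qed
  from bij_betw_same_card[OF this] show ?thesis
    unfolding root_count_def using fin by (subst (asm) card_SigmaI) auto
qed

text \<open>
  Conjugation by \<open>b\<close> permutes the square roots of \<open>g\<close>, and its fixed points are the roots that commute
  with \<open>b\<close>.
\<close>
lemma square_roots_cong_centralised:
  assumes fin: "finite (carrier G)" and p: "Factorial_Ring.prime (p::nat)"
    and b: "b \<in> carrier G" "b [^] p = \<one>" and g: "g \<in> carrier G" "g \<otimes> b = b \<otimes> g"
  shows "card (roots 2 g) mod p = card {u \<in> roots 2 g. u \<otimes> b = b \<otimes> u} mod p"
proof -
  let ?f = "\<lambda>u. b \<otimes> u \<otimes> inv b"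
  have fixg: "?f g = g" using b g by (metis inv_solve_right m_closed)
  have step: "?f u \<in> roots 2 g" if "u \<in> roots 2 g" for u
    using that conj_pow[OF b(1), of u 2] fixg b by simp
  have iter: "(?f ^^ i) u = b [^] i \<otimes> u \<otimes> inv (b [^] i)" if "u \<in> carrier G" for u i
  proof (induction i)
    case (Suc i)
    then have "(?f ^^ Suc i) u = (b \<otimes> b [^] i) \<otimes> u \<otimes> inv (b \<otimes> b [^] i)"
      using conj_conj[of "b [^] i" b u] b that by simp
    then show ?case using nat_pow_Suc2[OF b(1), of i] by simp
  qed (use that in simp)
  have "card (roots 2 g) mod p = card {u \<in> roots 2 g. ?f u = u} mod p"
    by (rule card_fixed_points_cong_prime[OF p]) (use fin step iter b in auto)
  moreover have "?f u = u \<longleftrightarrow> u \<otimes> b = b \<otimes> u" if "u \<in> carrier G" for u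
    using that b by (metis inv_solve_right m_closed)
  then have "{u \<in> roots 2 g. ?f u = u} = {u \<in> roots 2 g. u \<otimes> b = b \<otimes> u}" by blast
  ultimately show ?thesis by simp
qed

text \<open>
  A central subgroup of odd prime order \<open>p\<close> is invisible to square roots: squaring is bijective on
  it, so each square root of the image of \<open>x\<close> lifts to exactly one square root of \<open>x\<close>. This avoids
  splitting off the factor \<open>\<langle>b\<rangle>\<close> from the centraliser of \<open>b\<close>.
\<close>
lemma central_quotient:
  assumes fin: "finite (carrier G)" and p: "Factorial_Ring.prime (p::nat)" "odd p"
    and b: "b \<in> carrier G" "ord b = p" "\<forall>g\<in>carrier G. g \<otimes> b = b \<otimes> g"
  defines "N \<equiv> generate G {b}"
  shows "group (G Mod N)" "finite (carrier (G Mod N))" "order (G Mod N) * p = order G"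
    "\<And>x. x \<in> carrier G \<Longrightarrow> N #> x \<in> carrier (G Mod N)"
    "\<And>x. x \<in> carrier G \<Longrightarrow> \<not> p dvd ord x \<Longrightarrow> group.ord (G Mod N) (N #> x) = ord x"
    "\<And>x. x \<in> carrier G \<Longrightarrow> root_count (G Mod N) 2 (N #> x) = root_count G 2 x"
proof -
  have N: "subgroup N G" unfolding N_def using b by (intro generate_is_subgroup) auto
  have Nr: "N = range (\<lambda>k::nat. b [^] k)" unfolding N_def by (rule generate_singleton_eq_powers[OF fin b(1)])
  have Nc: "N \<subseteq> carrier G" using N by (rule subgroup.subset)
  have comm: "g \<otimes> b [^] i = b [^] i \<otimes> g" if "g \<in> carrier G" for g and i :: nat
    using pow_commute[OF b(1) that, of i] b(3) that by simp
  have cardN: "card N = p" unfolding N_def using generate_pow_card[OF b(1)] b by simp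
  have "g \<otimes> h \<otimes> inv g \<in> N" if gc: "g \<in> carrier G" and hN: "h \<in> N" for g h
  proof -
    obtain i :: nat where i: "h = b [^] i" using hN Nr by auto
    then have "g \<otimes> h \<otimes> inv g = h" using comm[OF gc, of i] gc b(1) by (simp add: m_assoc)
    then show ?thesis using hN by simp
  qed
  then have nrm: "N \<lhd> G" using N by (simp add: normal_inv_iff)
  interpret normal N G by (rule nrm)
  show Q: "group (G Mod N)" by (rule factorgroup_is_group)
  show "finite (carrier (G Mod N))" using fin by (simp add: carrier_FactGroup)
  have "order (G Mod N) = card (rcosets N)" by (simp add: order_def FactGroup_def)
  then show "order (G Mod N) * p = order G" using lagrange_finite[OF fin N] cardN by simp
  show car: "N #> x \<in> carrier (G Mod N)" if "x \<in> carrier G" for x using that by (auto simp: carrier_FactGroup)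
  have pw: "(N #> x) [^]\<^bsub>G Mod N\<^esub> (i::nat) = N #> x [^] i" if "x \<in> carrier G" for x i
    using FactGroup_pow[OF that] .
  have eqN: "N #> x = N #> y \<longleftrightarrow> (\<exists>i::nat. y = b [^] i \<otimes> x)" if "x \<in> carrier G" "y \<in> carrier G" for x y
  proof
    assume "N #> x = N #> y"
    then have "y \<in> N #> x" using rcos_self[OF that(2) N] by simp
    then show "\<exists>i::nat. y = b [^] i \<otimes> x" using Nr by (auto simp: r_coset_def)
  next
    assume "\<exists>i::nat. y = b [^] i \<otimes> x"
    then have "y \<in> N #> x" using Nr by (auto simp: r_coset_def)
    then show "N #> x = N #> y" using repr_independence[OF _ that(1) N] by blast
  qed
  show "group.ord (G Mod N) (N #> x) = ord x" if x: "x \<in> carrier G" and nd: "\<not> p dvd ord x" for x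
  proof -
    have "(N #> x) [^]\<^bsub>G Mod N\<^esub> m = \<one>\<^bsub>G Mod N\<^esub> \<longleftrightarrow> ord x dvd m" for m :: nat
    proof -
      have "(N #> x) [^]\<^bsub>G Mod N\<^esub> m = \<one>\<^bsub>G Mod N\<^esub> \<longleftrightarrow> N #> \<one> = N #> x [^] m"
        using pw[OF x, of m] coset_mult_one[OF Nc] by auto
      also have "\<dots> \<longleftrightarrow> (\<exists>i::nat. x [^] m = b [^] i)" using eqN[of \<one> "x [^] m"] x b by simp
      also have "\<dots> \<longleftrightarrow> ord x dvd m"
      proof
        assume "\<exists>i::nat. x [^] m = b [^] i"
        then obtain i :: nat where "x [^] m = b [^] i" by blast
        then have "(x [^] m) [^] p = (b [^] p) [^] i" using b by (simp add: nat_pow_pow mult.commute)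
        also have "b [^] p = \<one>" using b by auto
        finally have "x [^] (m * p) = \<one>" using x by (simp add: nat_pow_pow)
        then have "ord x dvd m * p" using pow_eq_id[OF x] by simp
        moreover have "coprime (ord x) p" using nd p prime_imp_coprime coprime_commute by blast
        ultimately show "ord x dvd m" by (simp add: coprime_dvd_mult_left_iff)
      next
        assume "ord x dvd m"
        then have "x [^] m = b [^] (0::nat)" using pow_eq_id[OF x] by simp
        then show "\<exists>i::nat. x [^] m = b [^] i" by blast
      qed
      finally show ?thesis .
    qed
    then show ?thesis using group.ord_unique[OF Q car[OF x]] by blast
  qed
  show "root_count (G Mod N) 2 (N #> x) = root_count G 2 x" if x: "x \<in> carrier G" for x
  proof -
    have sq: "(b [^] i \<otimes> g) [^] (2::nat) = b [^] (2 * i) \<otimes> g [^] (2::nat)" if "g \<in> carrier G" for g and i :: nat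
      using pow_mult_distrib[of "b [^] i" g 2] comm[OF that, of i] that b by (simp add: nat_pow_pow mult.commute)
    have "bij_betw (\<lambda>g. N #> g) (roots 2 x) {A \<in> carrier (G Mod N). A [^]\<^bsub>G Mod N\<^esub> (2::nat) = N #> x}"
      unfolding bij_betw_def
    proof
      show "inj_on (\<lambda>g. N #> g) (roots 2 x)"
      proof (rule inj_onI)
        fix g h assume gh: "g \<in> roots 2 x" "h \<in> roots 2 x" "N #> g = N #> h"
        then obtain i :: nat where i: "h = b [^] i \<otimes> g" using eqN by auto
        then have "b [^] (2 * i) \<otimes> x = x" using gh sq[of g i] by simp
        then have "b [^] (2 * i) = \<one>" using right_cancel[of x "b [^] (2 * i)" \<one>] x b(1) by simp
        then have "p dvd 2 * i" using pow_eq_id[OF b(1)] b by simp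
        moreover have "\<not> p dvd 2" using p primes_dvd_imp_eq[of p 2] by auto
        ultimately have "p dvd i" using p(1) prime_dvd_mult_iff by blast
        then have "b [^] i = \<one>" using pow_eq_id[OF b(1)] b by simp
        then show "g = h" using i gh by simp
      qed
      show "(\<lambda>g. N #> g) ` roots 2 x = {A \<in> carrier (G Mod N). A [^]\<^bsub>G Mod N\<^esub> (2::nat) = N #> x}"
      proof (intro equalityI subsetI)
        fix A assume "A \<in> {A \<in> carrier (G Mod N). A [^]\<^bsub>G Mod N\<^esub> (2::nat) = N #> x}"
        then obtain g where g: "g \<in> carrier G" "A = N #> g" "N #> g [^] (2::nat) = N #> x"
          using pw by (auto simp: carrier_FactGroup)
        then obtain i :: nat where i: "x = b [^] i \<otimes> g [^] (2::nat)" using eqN[of "g [^] (2::nat)" x] x by auto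
        obtain k where k: "p = 2 * k + 1" using p(2) oddE by blast
        \<comment> \<open>Modulo \<open>p = 2k + 1\<close>, the factor \<open>k + 1\<close> is the inverse of 2.\<close>
        let ?h = "b [^] ((k + 1) * i) \<otimes> g"
        have "(2 * ((k + 1) * i)) mod ord b = i mod ord b"
        proof -
          have "2 * ((k + 1) * i) = i + p * i" using k by (simp add: algebra_simps)
          then show ?thesis unfolding b(2) by (simp only: mod_mult_self2)
        qed
        then have "b [^] (2 * ((k + 1) * i)) = b [^] i" using pow_eq_iff_mod[OF b(1)] by blast
        then have "?h [^] (2::nat) = x" using sq[OF g(1), of "(k + 1) * i"] i by simp
        moreover have "N #> g = N #> ?h" using eqN[of g ?h] g b by auto
        moreover have "?h \<in> carrier G" using g b by simp
        ultimately show "A \<in> (\<lambda>g. N #> g) ` roots 2 x" using g(2) by (intro image_eqI[of _ _ ?h]) simp_all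
      next
        fix A assume "A \<in> (\<lambda>g. N #> g) ` roots 2 x"
        then obtain g where g: "g \<in> carrier G" "g [^] (2::nat) = x" "A = N #> g" by blast
        then show "A \<in> {A \<in> carrier (G Mod N). A [^]\<^bsub>G Mod N\<^esub> (2::nat) = N #> x}"
          using pw[OF g(1), of 2] car[OF g(1)] by simp
      qed
    qed
    from bij_betw_same_card[OF this] show ?thesis unfolding root_count_def by (rule sym)
  qed
qed

text \<open>
  Let \<open>n\<close> be the common order of \<open>x\<close> and \<open>y\<close>. Since \<open>p\<close> does not divide \<open>n\<close>, exactly one \<open>p\<close>-th root of \<open>x\<close> lies in \<open>\<langle>x\<rangle>\<close>, and it commutes with all
  square roots of \<open>x\<close>; likewise for \<open>y\<close>. The remaining \<open>p\<close>-th roots \<open>v\<close> of \<open>x\<close> and \<open>w\<close> of \<open>y\<close> are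
  therefore responsible for the strict inequality, and some \<open>v\<close> commutes with fewer square roots
  than some \<open>w\<close>. The subgroups \<open>\<langle>v\<^sup>n\<rangle>\<close> and \<open>\<langle>w\<^sup>n\<rangle>\<close> have order \<open>p\<close> and are conjugate, and a square root
  commutes with \<open>v\<close> exactly when it commutes with \<open>v\<^sup>n\<close>. The group \<open>E\<close> is the centraliser of
  \<open>b = w\<^sup>n\<close> modulo \<open>\<langle>b\<rangle>\<close>; the centraliser is proper because over \<open>G\<close> the root counts agree.
\<close>
lemma reduction_to_central_quotient:
  assumes fin: "finite (carrier G)" and p: "Factorial_Ring.prime p" "odd p"
    and p2: "\<not> p\<^sup>2 dvd order G"
    and x: "x \<in> carrier G" and y: "y \<in> carrier G" and ordxy: "ord x = ord y"
    and r2: "root_count G 2 x = root_count G 2 y" and rp: "root_count G p x = root_count G p y"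
    and r2p: "root_count G (2 * p) x < root_count G (2 * p) y"
  shows "\<exists>E :: 'a set monoid. \<exists>x' y'. group E \<and> finite (carrier E) \<and> 2 * p * order E \<le> order G \<and>
    \<not> p dvd order E \<and> x' \<in> carrier E \<and> y' \<in> carrier E \<and> group.ord E x' = group.ord E y' \<and>
    root_count E 2 x' < root_count E 2 y' \<and> root_count E 2 x' mod p = root_count E 2 y' mod p"
proof -
  define n where "n = ord x"
  have ny: "ord y = n" using ordxy n_def by simp
  obtain k where k: "p = 2 * k + 1" using p(2) oddE by blast
  have p1: "p > 1" using p(1) prime_gt_1_nat by blast
  let ?c = "\<lambda>g v. card {u \<in> roots 2 g. u \<otimes> v = v \<otimes> u}"
  have sum_less: "(\<Sum>v\<in>roots p x. ?c x v) < (\<Sum>v\<in>roots p y. ?c y v)"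
    using r2p root_count_double[OF fin k] by simp
  have cardp: "card (roots p x) = card (roots p y)" using rp by (simp add: root_count_def)
  have "\<not> p dvd n"
  proof
    assume pn: "p dvd n"
    have "roots p y \<noteq> {}"
    proof
      assume "roots p y = {}"
      then show False using sum_less by (simp only: sum.empty not_less_zero)
    qed
    then obtain w where w: "w \<in> carrier G" "w [^] p = y" by blast
    have "p * n dvd order G" using ord_prime_root[OF p(1) w] pn ny ord_dvd_group_order[OF w(1)] by simp
    then have "p * p dvd order G" using pn by (meson dvd_trans mult_dvd_mono dvd_refl)
    then show False using p2 by (simp add: power2_eq_square)
  qed
  then have copn: "coprime p n" using p(1) prime_imp_coprime by blast
  obtain s t where st: "p * s = n * t + 1"
    using bezout_nat[of p n] p1 copn by (auto simp: coprime_iff_gcd_eq_1)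
  have central_root: "g [^] s \<in> roots p g" "?c g (g [^] s) = root_count G 2 g"
    if g: "g \<in> carrier G" "ord g = n" for g
  proof -
    have "g [^] (s * p) = g [^] (1::nat)"
      unfolding pow_eq_iff_mod[OF g(1)] g(2) using st by (simp only: mult.commute[of s p] mod_mult_self4)
    then show "g [^] s \<in> roots p g" using g by (simp add: nat_pow_pow)
    have "u \<otimes> g [^] s = g [^] s \<otimes> u" if "u \<in> roots 2 g" for u
    proof -
      have u: "u \<in> carrier G" "u [^] (2::nat) = g" using that by auto
      then have "g \<otimes> u = u \<otimes> g" using pow_commute[of u u 2] by simp
      then show ?thesis using pow_commute[of g u s] g u by simp
    qed
    then have "{u \<in> roots 2 g. u \<otimes> g [^] s = g [^] s \<otimes> u} = roots 2 g" by blast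
    then show "?c g (g [^] s) = root_count G 2 g" by (simp add: root_count_def)
  qed
  define A where "A = roots p x - {x [^] s}"
  define B where "B = roots p y - {y [^] s}"
  have finr: "finite (roots l g)" for l g using fin by simp
  have cx: "x [^] s \<in> roots p x" "?c x (x [^] s) = root_count G 2 x"
    using central_root[OF x] n_def by simp_all
  have cy: "y [^] s \<in> roots p y" "?c y (y [^] s) = root_count G 2 y"
    using central_root[OF y] ny by simp_all
  have "\<exists>v\<in>A. \<exists>w\<in>B. ?c x v < ?c y w"
  proof (rule ex_less_if_sum_less)
    show "finite A" "finite B" unfolding A_def B_def using finr by simp_all
    show "card A = card B" unfolding A_def B_def
      using card_Diff_singleton[OF cx(1)] card_Diff_singleton[OF cy(1)] cardp by simp
    show "(\<Sum>v\<in>A. ?c x v) < (\<Sum>w\<in>B. ?c y w)"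
      using sum_less sum.remove[OF finr cx(1), of "?c x"] sum.remove[OF finr cy(1), of "?c y"] cx(2) cy(2) r2
      unfolding A_def B_def by simp
  qed
  then obtain v w where v: "v \<in> A" and w: "w \<in> B" and less: "?c x v < ?c y w" by blast
  \<comment> \<open>A \<open>p\<close>-th root outside \<open>\<langle>g\<rangle>\<close> differs from the one inside by an element of order \<open>p\<close>.\<close>
  have part: "ord (r [^] n) = p" "r [^] n \<otimes> g = g \<otimes> r [^] n"
    "\<And>u. u \<in> roots 2 g \<Longrightarrow> u \<otimes> r = r \<otimes> u \<longleftrightarrow> u \<otimes> r [^] n = r [^] n \<otimes> u"
    if g: "g \<in> carrier G" "ord g = n" and r: "r \<in> roots p g" "r \<noteq> g [^] s" for g r
  proof -
    have rc: "r \<in> carrier G" "r [^] p = g" using r by auto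
    have "r [^] (n * t) \<otimes> r = g [^] s"
      using st rc nat_pow_pow[OF rc(1), of p s] nat_pow_mult[OF rc(1), of "n * t" 1] by simp
    then have eq: "(r [^] n) [^] t \<otimes> r = g [^] s" using rc by (simp add: nat_pow_pow)
    have "r [^] n \<noteq> \<one>"
    proof
      assume "r [^] n = \<one>"
      then show False using eq r rc by simp
    qed
    moreover have "(r [^] n) [^] p = \<one>"
      using rc g nat_pow_pow[OF rc(1), of n p] nat_pow_pow[OF rc(1), of p n] pow_ord_eq_1[OF g(1)]
      by (simp add: mult.commute)
    then have "ord (r [^] n) dvd p" using pow_eq_id[of "r [^] n" p] rc by simp
    ultimately show "ord (r [^] n) = p"
      using p(1) ord_eq_1[of "r [^] n"] rc by (auto simp: prime_nat_iff)
    have rg: "r \<otimes> g = g \<otimes> r" using pow_commute[of r r p] rc by simp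
    show "r [^] n \<otimes> g = g \<otimes> r [^] n" using pow_commute[of r g n] rc g rg by simp
    fix u assume "u \<in> roots 2 g"
    then have u: "u \<in> carrier G" "u [^] (2::nat) = g" by auto
    have gu: "g \<otimes> u = u \<otimes> g" using pow_commute[of u u 2] u by simp
    show "u \<otimes> r = r \<otimes> u \<longleftrightarrow> u \<otimes> r [^] n = r [^] n \<otimes> u"
    proof
      assume "u \<otimes> r = r \<otimes> u"
      then show "u \<otimes> r [^] n = r [^] n \<otimes> u" using pow_commute[of r u n] u rc by simp
    next
      assume h: "u \<otimes> r [^] n = r [^] n \<otimes> u"
      note C = subgroup_centralizer_of[OF u(1)]
      have "(r [^] n) [^] t \<in> centralizer_of u"
        using pow_commute[OF nat_pow_closed[OF rc(1)] u(1) h[symmetric], of t] rc(1)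
        by (simp add: centralizer_of_def)
      moreover have "g [^] s \<in> centralizer_of u"
        using pow_commute[OF g(1) u(1) gu, of s] g(1) by (simp add: centralizer_of_def)
      ultimately have "inv ((r [^] n) [^] t) \<otimes> g [^] s \<in> centralizer_of u"
        by (intro subgroup.m_closed[OF C] subgroup.m_inv_closed[OF C])
      also have "inv ((r [^] n) [^] t) \<otimes> g [^] s = r"
        using eq rc g by (simp add: inv_solve_left')
      finally show "u \<otimes> r = r \<otimes> u" by (simp add: centralizer_of_def)
    qed
  qed
  have vr: "v \<in> roots p x" "v \<noteq> x [^] s" and wr: "w \<in> roots p y" "w \<noteq> y [^] s"
    using v w unfolding A_def B_def by auto
  note partv = part[OF x n_def[symmetric] vr] and partw = part[OF y ny wr]
  define b where "b = w [^] n"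
  define b' where "b' = v [^] n"
  have bc: "b \<in> carrier G" "b' \<in> carrier G" unfolding b_def b'_def using vr wr by auto
  have ordb: "ord b = p" "ord b' = p" unfolding b_def b'_def using partv partw by simp_all
  let ?S = "generate G {b}"
  have S: "subgroup ?S G" using bc by (intro generate_is_subgroup) auto
  have cS: "card ?S = p" using generate_pow_card[OF bc(1)] ordb by simp
  have pdvd: "p dvd order G" using ord_dvd_group_order[OF bc(1)] ordb by simp
  have "\<not> p dvd order G div card ?S"
  proof
    assume "p dvd order G div card ?S"
    then have "p * p dvd p * (order G div p)" using cS by simp
    then have "p * p dvd order G" using pdvd by simp
    then show False using p2 by (simp add: power2_eq_square)
  qed
  moreover have "b' [^] (p ^ 1) = \<one>" using ordb pow_ord_eq_1[OF bc(2)] by simp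
  ultimately obtain z where z: "z \<in> carrier G" "z \<otimes> b' \<otimes> inv z \<in> ?S"
    using conj_into_Sylow[OF p(1) fin S _ bc(2)] by blast
  define b1 where "b1 = z \<otimes> b' \<otimes> inv z"
  define x1 where "x1 = z \<otimes> x \<otimes> inv z"
  have b1: "b1 \<in> carrier G" "ord b1 = p" unfolding b1_def using z bc ord_conj[OF z(1) bc(2)] ordb by simp_all
  have x1: "x1 \<in> carrier G" "ord x1 = n" unfolding x1_def using z x ord_conj[OF z(1) x] n_def by simp_all
  have "generate G {b1} \<subseteq> ?S" using generate_subgroup_incl[OF _ S, of "{b1}"] z b1_def by simp
  moreover have "finite ?S" using fin subgroup.subset[OF S] finite_subset by blast
  ultimately have "generate G {b1} = ?S"
    using card_subset_eq[of ?S "generate G {b1}"] cS generate_pow_card[OF b1(1)] b1 by simp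
  then have "b \<in> generate G {b1}" "b1 \<in> generate G {b}"
    using generate.incl[of b "{b}" G] generate.incl[of b1 "{b1}" G] by simp_all
  then obtain i j :: nat where ij: "b = b1 [^] i" "b1 = b [^] j"
    using generate_singleton_eq_powers[OF fin b1(1)] generate_singleton_eq_powers[OF fin bc(1)] by auto
  have cb: "u \<otimes> b1 = b1 \<otimes> u \<longleftrightarrow> u \<otimes> b = b \<otimes> u" if "u \<in> carrier G" for u
  proof
    assume h: "u \<otimes> b1 = b1 \<otimes> u"
    show "u \<otimes> b = b \<otimes> u"
      unfolding ij(1) using pow_commute[OF b1(1) that h[symmetric], of i] by (rule sym)
  next
    assume h: "u \<otimes> b = b \<otimes> u"
    show "u \<otimes> b1 = b1 \<otimes> u"
      unfolding ij(2) using pow_commute[OF bc(1) that h[symmetric], of j] by (rule sym)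
  qed
  define C where "C = centralizer_of b"
  define D where "D = G\<lparr>carrier := C\<rparr>"
  have C: "subgroup C G" unfolding C_def by (rule subgroup_centralizer_of[OF bc(1)])
  have xb: "x1 \<otimes> b = b \<otimes> x1"
  proof -
    have "x1 \<otimes> b1 = b1 \<otimes> x1"
      unfolding x1_def b1_def using partv(2) conj_mult_distrib[OF z(1) x bc(2)] conj_mult_distrib[OF z(1) bc(2) x]
      by (simp add: b'_def)
    then show ?thesis using cb x1 by simp
  qed
  have yb: "y \<otimes> b = b \<otimes> y" using partw(2) by (simp add: b_def)
  have xC: "x1 \<in> C" and yC: "y \<in> C" unfolding C_def centralizer_of_def using xb yb x1 y by simp_all
  have rcD: "root_count D 2 g = card {u \<in> roots 2 g. u \<otimes> b = b \<otimes> u}" for g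
  proof -
    have "{h \<in> carrier D. h [^]\<^bsub>D\<^esub> (2::nat) = g} = {u \<in> roots 2 g. u \<otimes> b = b \<otimes> u}"
      unfolding D_def C_def centralizer_of_def nat_pow_def by auto
    then show ?thesis unfolding root_count_def by simp
  qed
  have "{u \<in> roots 2 x. u \<otimes> v = v \<otimes> u} = {u \<in> roots 2 x. u \<otimes> b' = b' \<otimes> u}"
    unfolding b'_def using partv(3) by blast
  then have "?c x v = card {u \<in> roots 2 x. u \<otimes> b' = b' \<otimes> u}" by (rule arg_cong)
  also have "\<dots> = card {u \<in> roots 2 x1. u \<otimes> b1 = b1 \<otimes> u}"
  proof (rule bij_betw_same_card, rule bij_betw_byWitness[where f' = "\<lambda>h. inv z \<otimes> h \<otimes> z"])
    show "\<forall>a\<in>{u \<in> roots 2 x. u \<otimes> b' = b' \<otimes> u}. inv z \<otimes> (z \<otimes> a \<otimes> inv z) \<otimes> z = a"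
      using conj_inverse(2)[OF z(1)] by blast
    show "\<forall>a'\<in>{u \<in> roots 2 x1. u \<otimes> b1 = b1 \<otimes> u}. z \<otimes> (inv z \<otimes> a' \<otimes> z) \<otimes> inv z = a'"
      using conj_inverse(1)[OF z(1)] by blast
    show "(\<lambda>a. z \<otimes> a \<otimes> inv z) ` {u \<in> roots 2 x. u \<otimes> b' = b' \<otimes> u} \<subseteq> {u \<in> roots 2 x1. u \<otimes> b1 = b1 \<otimes> u}"
    proof (intro image_subsetI CollectI conjI)
      fix u assume "u \<in> {u \<in> roots 2 x. u \<otimes> b' = b' \<otimes> u}"
      then have u: "u \<in> carrier G" "u [^] (2::nat) = x" "u \<otimes> b' = b' \<otimes> u" by auto
      show "z \<otimes> u \<otimes> inv z \<in> carrier G" using u z by simp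
      show "(z \<otimes> u \<otimes> inv z) [^] (2::nat) = x1" using conj_pow[OF z(1) u(1), of 2] u x1_def by simp
      show "z \<otimes> u \<otimes> inv z \<otimes> b1 = b1 \<otimes> (z \<otimes> u \<otimes> inv z)"
        unfolding b1_def using conj_mult_distrib[OF z(1) u(1) bc(2)] conj_mult_distrib[OF z(1) bc(2) u(1)] u by simp
    qed
    show "(\<lambda>h. inv z \<otimes> h \<otimes> z) ` {u \<in> roots 2 x1. u \<otimes> b1 = b1 \<otimes> u} \<subseteq> {u \<in> roots 2 x. u \<otimes> b' = b' \<otimes> u}"
    proof (intro image_subsetI CollectI conjI)
      fix u assume "u \<in> {u \<in> roots 2 x1. u \<otimes> b1 = b1 \<otimes> u}"
      then have u: "u \<in> carrier G" "u [^] (2::nat) = x1" "u \<otimes> b1 = b1 \<otimes> u" by auto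
      have iz: "inv z \<in> carrier G" "inv (inv z) = z" using z by simp_all
      have b'z: "b' = inv z \<otimes> b1 \<otimes> z" unfolding b1_def using conj_inverse(2)[OF z(1) bc(2)] by simp
      have xz: "x = inv z \<otimes> x1 \<otimes> z" unfolding x1_def using conj_inverse(2)[OF z(1) x] by simp
      show "inv z \<otimes> u \<otimes> z \<in> carrier G" using u z by simp
      show "(inv z \<otimes> u \<otimes> z) [^] (2::nat) = x"
        using conj_pow[OF iz(1) u(1), of 2] u(2) xz iz(2) by simp
      show "inv z \<otimes> u \<otimes> z \<otimes> b' = b' \<otimes> (inv z \<otimes> u \<otimes> z)"
        using conj_mult_distrib[OF iz(1) u(1) b1(1)] conj_mult_distrib[OF iz(1) b1(1) u(1)] u(3) b'z iz(2) by simp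
    qed
  qed
  also have "\<dots> = root_count D 2 x1"
    unfolding rcD using cb by (intro arg_cong[of _ _ card]) blast
  finally have cvx: "?c x v = root_count D 2 x1" .
  have "{u \<in> roots 2 y. u \<otimes> w = w \<otimes> u} = {u \<in> roots 2 y. u \<otimes> b = b \<otimes> u}"
    unfolding b_def using partw(3) by blast
  then have cwy: "?c y w = root_count D 2 y" unfolding rcD by (rule arg_cong)
  have lessD: "root_count D 2 x1 < root_count D 2 y" using less cvx cwy by simp
  have bp: "b [^] p = \<one>" using ordb pow_ord_eq_1[OF bc(1)] by simp
  have rx1: "root_count G 2 x1 = root_count G 2 y" unfolding x1_def using root_count_conj[OF z(1) x] r2 by simp
  have modD: "root_count D 2 x1 mod p = root_count D 2 y mod p"
    using square_roots_cong_centralised[OF fin p(1) bc(1) bp x1(1) xb]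
      square_roots_cong_centralised[OF fin p(1) bc(1) bp y yb] rx1[unfolded root_count_def]
    unfolding rcD by simp
  have "C \<noteq> carrier G"
  proof
    assume "C = carrier G"
    then have "D = G" unfolding D_def by simp
    then show False using lessD rx1 by simp
  qed
  then have "card C \<noteq> order G"
    using card_subset_eq[OF fin subgroup.subset[OF C]] by (auto simp: order_def)
  then have "card (rcosets C) \<noteq> 1" using lagrange[OF C] by auto
  moreover have "card (rcosets C) \<noteq> 0"
  proof
    assume "card (rcosets C) = 0"
    then have "order G = 0" using lagrange[OF C] by simp
    then show False using fin order_gt_0_iff_finite by simp
  qed
  ultimately have "2 \<le> card (rcosets C)" by linarith
  then have half: "2 * card C \<le> order G"
    using mult_le_mono1[of 2 "card (rcosets C)" "card C"] lagrange[OF C] by simp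
  have CG: "card C dvd order G"
    using dvd_triv_right[of "card C" "card (rcosets C)"] lagrange[OF C] by simp
  interpret DG: group D unfolding D_def by (rule subgroup_imp_group[OF C])
  have carD: "carrier D = C" by (simp add: D_def)
  have bC: "b \<in> carrier D" using bc by (simp add: D_def C_def centralizer_of_def)
  have finD: "finite (carrier D)" using fin subgroup.subset[OF C] finite_subset carD by auto
  have ordD: "DG.ord g = ord g" if "g \<in> C" for g unfolding D_def by (rule ord_subgroup[OF C that])
  have bD: "DG.ord b = p" using ordD bC carD ordb by simp
  have cenD: "\<forall>g\<in>carrier D. g \<otimes>\<^bsub>D\<^esub> b = b \<otimes>\<^bsub>D\<^esub> g"
    by (simp add: D_def C_def centralizer_of_def)
  note quo = DG.central_quotient[OF finD p bC bD cenD]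
  let ?N = "generate D {b}"
  have ordE: "order (D Mod ?N) * p = card C" using quo(3) by (simp add: order_def carD)
  have "\<not> p dvd order (D Mod ?N)"
  proof
    assume "p dvd order (D Mod ?N)"
    then have "p * p dvd card C" unfolding ordE[symmetric] by (rule mult_dvd_mono[OF _ dvd_refl])
    then have "p * p dvd order G" using CG by (rule dvd_trans)
    then show False using p2 by (simp add: power2_eq_square)
  qed
  moreover have nd: "\<not> p dvd DG.ord x1" "\<not> p dvd DG.ord y"
    using ordD xC yC x1 ny \<open>\<not> p dvd n\<close> by simp_all
  moreover have "2 * p * order (D Mod ?N) \<le> order G" using half ordE by (simp add: algebra_simps)
  moreover have xyD: "x1 \<in> carrier D" "y \<in> carrier D" using xC yC carD by simp_all
  moreover have "group.ord (D Mod ?N) (?N #>\<^bsub>D\<^esub> x1) = group.ord (D Mod ?N) (?N #>\<^bsub>D\<^esub> y)"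
    unfolding quo(5)[OF xyD(1) nd(1)] quo(5)[OF xyD(2) nd(2)] using ordD xC yC x1 ny by simp
  moreover note quo(1,2) quo(4)[OF xyD(1)] quo(4)[OF xyD(2)]
    lessD[folded quo(6)[OF xyD(1)] quo(6)[OF xyD(2)]] modD[folded quo(6)[OF xyD(1)] quo(6)[OF xyD(2)]]
  ultimately show ?thesis
    by (intro exI[of _ "D Mod ?N"] exI[of _ "?N #>\<^bsub>D\<^esub> x1"] exI[of _ "?N #>\<^bsub>D\<^esub> y"] conjI)
qed

end

section \<open>Bounding the square roots by the centraliser\<close>

context group
begin

text \<open>
  Cauchy's theorem, read off from a subgroup of order \<open>q\<close>.
\<close>
lemma exists_element_of_prime_order:
  assumes fin: "finite (carrier G)" and q: "Factorial_Ring.prime (q::nat)" "q dvd order G"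
  shows "\<exists>c\<in>carrier G. ord c = q"
proof -
  have "order G = q ^ 1 * (order G div q)" using q(2) by simp
  then obtain H where H: "subgroup H G" "card H = q ^ 1" using sylow_thm[OF q(1) is_group _ fin] by blast
  have q1: "q > 1" using q(1) prime_gt_1_nat by blast
  have "\<not> H \<subseteq> {\<one>}"
  proof
    assume "H \<subseteq> {\<one>}"
    then have "card H \<le> 1" using card_mono[of "{\<one>}" H] by simp
    then show False using H(2) q1 by simp
  qed
  then obtain h where h: "h \<in> H" "h \<noteq> \<one>" by blast
  have hc: "h \<in> carrier G" using subgroup.mem_carrier[OF H(1) h(1)] .
  interpret HG: group "G\<lparr>carrier := H\<rparr>" by (rule subgroup_imp_group[OF H(1)])
  have "HG.ord h dvd order (G\<lparr>carrier := H\<rparr>)" using HG.ord_dvd_group_order[of h] h(1) by simp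
  then have "ord h dvd q" using H(2) ord_subgroup[OF H(1) h(1)] by (simp add: order_def)
  moreover have "ord h \<noteq> 1" using ord_eq_1[OF hc] h(2) by simp
  ultimately have "ord h = q" using q(1) by (auto simp: prime_nat_iff)
  then show ?thesis using hc by blast
qed

lemma roots_in_centralizer:
  assumes "u \<in> roots 2 y"
  shows "u \<in> centralizer_of y"
proof -
  have u: "u \<in> carrier G" "u [^] (2::nat) = y" using assms by auto
  then show ?thesis using pow_commute[of u u 2] by (simp add: centralizer_of_def)
qed

text \<open>
  If \<open>e\<close> is the involution in \<open>\<langle>x\<rangle>\<close>, then \<open>u \<mapsto> u e\<close> pairs off the square roots of \<open>x\<close>.
\<close>
lemma even_root_count:
  assumes fin: "finite (carrier G)" and x: "x \<in> carrier G" "even (ord x)"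
  shows "even (root_count G 2 x)"
proof -
  define m where "m = ord x div 2"
  have m: "ord x = 2 * m" unfolding m_def using x(2) by simp
  have m0: "m > 0" using m ord_ge_1[OF fin x(1)] by simp
  define e where "e = x [^] m"
  have e: "e \<in> carrier G" unfolding e_def using x by simp
  have ee: "e \<otimes> e = \<one>" unfolding e_def using x m pow_ord_eq_1[OF x(1)] by (simp add: nat_pow_mult mult_2)
  have e1: "e \<noteq> \<one>"
  proof
    assume "e = \<one>"
    then have "2 * m dvd m" unfolding e_def using pow_eq_id[OF x(1)] m by simp
    then show False using m0 dvd_imp_le by fastforce
  qed
  let ?f = "\<lambda>u. u \<otimes> e"
  have fixp: "card (roots 2 x) mod 2 = card {u \<in> roots 2 x. ?f u = u} mod 2"
  proof (rule card_fixed_points_cong_prime)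
    show "Factorial_Ring.prime (2::nat)" by (rule two_is_prime_nat)
    show "finite (roots 2 x)" using fin by simp
    fix u assume u: "u \<in> roots 2 x"
    then have uc: "u \<in> carrier G" "u [^] (2::nat) = x" by auto
    have "x \<otimes> u = u \<otimes> x" using pow_commute[of u u 2] uc by simp
    then have ue: "e \<otimes> u = u \<otimes> e" unfolding e_def using pow_commute[of x u m] x uc by simp
    have "(u \<otimes> e) [^] (2::nat) = x \<otimes> e [^] (2::nat)"
      using pow_mult_distrib[OF ue[symmetric] uc(1) e, of 2] uc by simp
    also have "e [^] (2::nat) = \<one>" using ee e by (simp add: numeral_2_eq_2)
    finally show "?f u \<in> roots 2 x" using uc e x by simp
    show "(?f ^^ 2) u = u" using uc e ee by (simp add: numeral_2_eq_2 m_assoc)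
  qed
  have "{u \<in> roots 2 x. ?f u = u} = {}" using e1 e by auto
  then have "card (roots 2 x) mod 2 = 0" using fixp by (simp only: card.empty mod_0)
  then show ?thesis unfolding root_count_def by (rule mod_0_imp_dvd)
qed

text \<open>
  The square \<open>y\<^bsup>2i+1\<^esup>\<close> of \<open>u y\<^sup>i\<close> determines \<open>i\<close> in the stated range, and then \<open>u\<close> as well. The range
  must be cut to half the order of \<open>y\<close> when that order is even.
\<close>
lemma inj_on_root_pow:
  assumes y: "y \<in> carrier G"
    and N: "\<forall>i<N. \<forall>j<N. 2 * i mod ord y = 2 * j mod ord y \<longrightarrow> i = j"
  shows "inj_on (\<lambda>(u, i::nat). u \<otimes> y [^] i) (roots 2 y \<times> {..<N})"
    "(\<lambda>(u, i::nat). u \<otimes> y [^] i) ` (roots 2 y \<times> {..<N}) \<subseteq> centralizer_of y"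
    "\<And>u i. u \<in> roots 2 y \<Longrightarrow> (u \<otimes> y [^] (i::nat)) [^] (2::nat) = y [^] (2 * i + 1)"
proof -
  show sq: "(u \<otimes> y [^] i) [^] (2::nat) = y [^] (2 * i + 1)" if "u \<in> roots 2 y" for u and i :: nat
  proof -
    have u: "u \<in> carrier G" "u [^] (2::nat) = y" using that by auto
    have "y \<otimes> u = u \<otimes> y" using roots_in_centralizer[OF that] by (simp add: centralizer_of_def)
    then have "u \<otimes> y [^] i = y [^] i \<otimes> u" using pow_commute[OF y u(1), of i] by simp
    then have "(u \<otimes> y [^] i) [^] (2::nat) = y \<otimes> (y [^] i) [^] (2::nat)"
      using pow_mult_distrib[of u "y [^] i" 2] u y by simp
    also have "\<dots> = y \<otimes> y [^] (2 * i)" using nat_pow_pow[OF y, of i 2] by (simp add: mult.commute)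
    also have "\<dots> = y [^] (2 * i + 1)" using nat_pow_Suc2[OF y, of "2 * i"] by simp
    finally show ?thesis .
  qed
  show "inj_on (\<lambda>(u, i::nat). u \<otimes> y [^] i) (roots 2 y \<times> {..<N})"
  proof (rule inj_onI)
    fix c d assume cd: "c \<in> roots 2 y \<times> {..<N}" "d \<in> roots 2 y \<times> {..<N}"
      "(\<lambda>(u, i::nat). u \<otimes> y [^] i) c = (\<lambda>(u, i::nat). u \<otimes> y [^] i) d"
    obtain u i where c: "c = (u, i)" by (cases c)
    obtain v j where d: "d = (v, j)" by (cases d)
    have uv: "u \<in> roots 2 y" "v \<in> roots 2 y" "i < N" "j < N" using cd c d by simp_all
    have eq: "u \<otimes> y [^] i = v \<otimes> y [^] j" using cd(3) c d by simp
    then have "y [^] (2 * i + 1) = y [^] (2 * j + 1)" using sq[OF uv(1), of i] sq[OF uv(2), of j] by simp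
    then have "y [^] (2 * i) = y [^] (2 * j)" using y by simp
    then have "2 * i mod ord y = 2 * j mod ord y" using pow_eq_iff_mod[OF y] by blast
    then have ij: "i = j" using N uv by simp
    then have "u = v" using eq y uv(1,2) by simp
    then show "c = d" using ij c d by simp
  qed
  show "(\<lambda>(u, i::nat). u \<otimes> y [^] i) ` (roots 2 y \<times> {..<N}) \<subseteq> centralizer_of y"
  proof (rule image_subsetI)
    fix c assume c: "c \<in> roots 2 y \<times> {..<N}"
    obtain u i where ui: "c = (u, i)" by (cases c)
    have "u \<in> roots 2 y" using c ui by simp
    then have "u \<in> centralizer_of y" by (rule roots_in_centralizer)
    moreover have "y [^] i \<in> centralizer_of y" using pow_commute[OF y y refl, of i] y by (simp add: centralizer_of_def)
    ultimately have "u \<otimes> y [^] i \<in> centralizer_of y" by (rule subgroup.m_closed[OF subgroup_centralizer_of[OF y]])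
    then show "(\<lambda>(u, i::nat). u \<otimes> y [^] i) c \<in> centralizer_of y" using ui by simp
  qed
qed

lemma finite_centralizer_of:
  assumes "finite (carrier G)"
  shows "finite (centralizer_of y)" "card (centralizer_of y) \<le> order G"
  using assms unfolding centralizer_of_def order_def by (auto intro: card_mono)

lemma card_centralizer_dvd:
  assumes "y \<in> carrier G"
  shows "card (centralizer_of y) dvd order G"
  using dvd_triv_right[of "card (centralizer_of y)" "card (rcosets (centralizer_of y))"]
    lagrange[OF subgroup_centralizer_of[OF assms]] by simp

lemma centralizer_of_full:
  assumes "finite (carrier G)" "card (centralizer_of y) = order G"
  shows "centralizer_of y = carrier G"
  using card_subset_eq[of "carrier G" "centralizer_of y"] assms by (auto simp: order_def centralizer_of_def)

text \<open>
  The products \<open>u y\<^sup>i\<close> of a square root \<open>u\<close> of \<open>y\<close> with a power of \<open>y\<close> are all distinct. The second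
  statement records that they fill the centraliser when the bound is attained.
\<close>
lemma odd_order_root_bound:
  assumes fin: "finite (carrier G)" and y: "y \<in> carrier G" "odd (ord y)"
  shows "ord y * root_count G 2 y \<le> card (centralizer_of y)"
    "ord y * root_count G 2 y = card (centralizer_of y) \<Longrightarrow> g \<in> centralizer_of y \<Longrightarrow>
      \<exists>u\<in>roots 2 y. \<exists>i::nat. g = u \<otimes> y [^] i"
proof -
  let ?f = "\<lambda>(u, i::nat). u \<otimes> y [^] i" and ?D = "roots 2 y \<times> {..< ord y}"
  have N: "\<forall>i < ord y. \<forall>j < ord y. 2 * i mod ord y = 2 * j mod ord y \<longrightarrow> i = j"
  proof (intro allI impI)
    fix i j assume ij: "i < ord y" "j < ord y" "2 * i mod ord y = 2 * j mod ord y"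
    have "coprime (ord y) 2" using y(2) by simp
    have *: "a = b" if "a \<le> b" "b < ord y" "2 * a mod ord y = 2 * b mod ord y" for a b
    proof -
      have "ord y dvd 2 * b - 2 * a" using that(1,3) mod_eq_dvd_iff_nat[of "2 * a" "2 * b" "ord y"] by simp
      then have "ord y dvd 2 * (b - a)" by (simp add: diff_mult_distrib2)
      then have "ord y dvd b - a" using \<open>coprime (ord y) 2\<close> coprime_dvd_mult_right_iff by blast
      then show "a = b" using that(1,2) dvd_imp_le[of "ord y" "b - a"] by (cases "a = b") auto
    qed
    show "i = j" using *[of i j] *[of j i] ij by (cases "i \<le> j") auto
  qed
  note inj = inj_on_root_pow[OF y(1) N]
  have card_im: "card (?f ` ?D) = ord y * root_count G 2 y"
    using card_image[OF inj(1)] by (simp add: card_cartesian_product root_count_def)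
  then show "ord y * root_count G 2 y \<le> card (centralizer_of y)"
    using card_mono[OF finite_centralizer_of(1)[OF fin] inj(2)] by simp
  assume "ord y * root_count G 2 y = card (centralizer_of y)" and g: "g \<in> centralizer_of y"
  then have "?f ` ?D = centralizer_of y"
    using card_subset_eq[OF finite_centralizer_of(1)[OF fin] inj(2)] card_im by simp
  then have "g \<in> ?f ` ?D" using g by simp
  then obtain d where d: "d \<in> ?D" "g = ?f d" by blast
  obtain u i where "d = (u, i)" by (cases d)
  then have "u \<in> roots 2 y" "g = u \<otimes> y [^] i" using d by simp_all
  then show "\<exists>u\<in>roots 2 y. \<exists>i::nat. g = u \<otimes> y [^] i" by blast
qed

text \<open>
  In even order the products \<open>u y\<^sup>i\<close> coincide in pairs, but they miss \<open>\<langle>y\<rangle>\<close>: their squares are odd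
  powers of \<open>y\<close>, those of elements of \<open>\<langle>y\<rangle>\<close> are even powers. The second statement describes the
  elements of the centraliser when the bound is attained.
\<close>
lemma even_order_root_bound:
  assumes fin: "finite (carrier G)" and y: "y \<in> carrier G" "ord y = 2 * m"
  shows "m * root_count G 2 y + 2 * m \<le> card (centralizer_of y)"
    "m * root_count G 2 y + 2 * m = card (centralizer_of y) \<Longrightarrow> g \<in> centralizer_of y \<Longrightarrow>
      (\<exists>i::nat. g = y [^] i) \<or> (\<exists>i::nat. g [^] (2::nat) = y [^] (2 * i + 1))"
proof -
  let ?f = "\<lambda>(u, i::nat). u \<otimes> y [^] i" and ?D = "roots 2 y \<times> {..<m}"
  let ?Y = "generate G {y}"
  have Yr: "?Y = range (\<lambda>k::nat. y [^] k)" by (rule generate_singleton_eq_powers[OF fin y(1)])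
  have N: "\<forall>i<m. \<forall>j<m. 2 * i mod ord y = 2 * j mod ord y \<longrightarrow> i = j"
    using y(2) by simp
  note inj = inj_on_root_pow[OF y(1) N]
  have card_im: "card (?f ` ?D) = m * root_count G 2 y"
    using card_image[OF inj(1)] by (simp add: card_cartesian_product root_count_def)
  have cY: "card ?Y = 2 * m" using generate_pow_card[OF y(1)] y(2) by simp
  have YC: "?Y \<subseteq> centralizer_of y"
    using generate_subgroup_incl[OF _ subgroup_centralizer_of[OF y(1)], of "{y}"] y(1)
    by (simp add: centralizer_of_def)
  have disj: "?f ` ?D \<inter> ?Y = {}"
  proof (rule equals0I)
    fix g assume "g \<in> ?f ` ?D \<inter> ?Y"
    then obtain d where d: "d \<in> ?D" "g = ?f d" and "g \<in> ?Y" by blast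
    obtain u i where "d = (u, i)" by (cases d)
    then have h: "u \<in> roots 2 y" "g = u \<otimes> y [^] i" using d by simp_all
    obtain k :: nat where k: "g = y [^] k" using \<open>g \<in> ?Y\<close> unfolding Yr by (rule rangeE)
    have "y [^] (2 * k) = g [^] (2::nat)" using k nat_pow_pow[OF y(1), of k 2] by (simp add: mult.commute)
    also have "\<dots> = y [^] (2 * i + 1)" using inj(3)[OF h(1), of i] h(2) by simp
    finally have eq: "2 * k mod (2 * m) = (2 * i + 1) mod (2 * m)"
      unfolding pow_eq_iff_mod[OF y(1)] y(2) .
    have "2 * k mod (2 * m) mod 2 = 2 * k mod 2" by (rule mod_mod_cancel) simp
    moreover have "(2 * i + 1) mod (2 * m) mod 2 = (2 * i + 1) mod 2" by (rule mod_mod_cancel) simp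
    ultimately have "2 * k mod 2 = (2 * i + 1) mod 2" using eq by (simp only:)
    then show False by presburger
  qed
  have fins: "finite (?f ` ?D)" "finite ?Y"
    using fin finite_centralizer_of(1)[OF fin] YC finite_subset by auto
  have cU: "card (?f ` ?D \<union> ?Y) = m * root_count G 2 y + 2 * m"
    using card_Un_disjoint[OF fins disj] card_im cY by simp
  have sub: "?f ` ?D \<union> ?Y \<subseteq> centralizer_of y" using inj(2) YC by simp
  show "m * root_count G 2 y + 2 * m \<le> card (centralizer_of y)"
    using card_mono[OF finite_centralizer_of(1)[OF fin] sub] cU by simp
  assume "m * root_count G 2 y + 2 * m = card (centralizer_of y)" and g: "g \<in> centralizer_of y"
  then have "?f ` ?D \<union> ?Y = centralizer_of y"
    using card_subset_eq[OF finite_centralizer_of(1)[OF fin] sub] cU by simp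
  then have "g \<in> ?f ` ?D \<or> g \<in> ?Y" using g by blast
  then show "(\<exists>i::nat. g = y [^] i) \<or> (\<exists>i::nat. g [^] (2::nat) = y [^] (2 * i + 1))"
  proof
    assume "g \<in> ?f ` ?D"
    then obtain d where d: "d \<in> ?D" "g = ?f d" by blast
    obtain u i where "d = (u, i)" by (cases d)
    then have "u \<in> roots 2 y" "g = u \<otimes> y [^] i" using d by simp_all
    then have "g [^] (2::nat) = y [^] (2 * i + 1)" using inj(3) by simp
    then show ?thesis by blast
  next
    assume "g \<in> ?Y"
    then show ?thesis unfolding Yr by blast
  qed
qed

end

section \<open>Ten square roots of an involution\<close>

lemma dvd_eq_if_less_double:
  fixes d n :: nat
  assumes "d dvd n" "0 < n" "n < 2 * d"
  shows "d = n"
proof -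
  obtain k where k: "n = d * k" using assms(1) by blast
  have "k < 2"
  proof (rule ccontr)
    assume "\<not> k < 2"
    then have "d * 2 \<le> d * k" by (intro mult_le_mono2) simp
    then show False using assms(3) k by simp
  qed
  moreover have "k \<noteq> 0" using assms(2) k by auto
  ultimately have "k = 1" by linarith
  then show ?thesis using k by simp
qed

context group
begin

text \<open>
  Suppose there are ten square roots; the other six elements are the four of \<open>V = {1, x, y, xy}\<close> and
  \<open>s\<close>, \<open>sy\<close> for some \<open>s\<close>. If \<open>g\<close> and \<open>xg\<close> are both roots of the central \<open>y\<close>, then \<open>x\<close> commutes with
  \<open>g\<close>. At most two roots \<open>g\<close> fail this, so \<open>x\<close> commutes with at least \<open>8 + 4\<close> elements and is central.
  But then \<open>xs\<close> is a seventh element that is not a root.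
\<close>
lemma order_16_root_count_ne_10:
  assumes fin: "finite (carrier G)" and o: "order G = 16"
    and x: "x \<in> carrier G" "ord x = 2" and y: "y \<in> carrier G" "ord y = 2" and xy: "x \<noteq> y"
    and cen: "\<forall>g\<in>carrier G. g \<otimes> y = y \<otimes> g"
  shows "card (roots 2 y) \<noteq> 10"
proof
  assume r: "card (roots 2 y) = 10"
  let ?R = "roots 2 y"
  define M where "M = carrier G - ?R"
  have sq: "g [^] (2::nat) = g \<otimes> g" if "g \<in> carrier G" for g using that by (simp add: numeral_2_eq_2)
  have xx: "x \<otimes> x = \<one>" using pow_ord_eq_1[OF x(1)] x sq by simp
  have yy: "y \<otimes> y = \<one>" using pow_ord_eq_1[OF y(1)] y sq by simp
  have x1: "x \<noteq> \<one>" using x by auto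
  have y1: "y \<noteq> \<one>" using y by auto
  have xyc: "x \<otimes> y = y \<otimes> x" using cen x by simp
  have xxg: "x \<otimes> (x \<otimes> g) = g" if "g \<in> carrier G" for g using that x xx by (simp flip: m_assoc)
  have gyy: "g \<otimes> y \<otimes> y = g" if "g \<in> carrier G" for g using that y yy by (simp add: m_assoc)
  have R: "g \<in> ?R \<longleftrightarrow> g \<in> carrier G \<and> g \<otimes> g = y" for g using sq by auto
  have M: "g \<in> M \<longleftrightarrow> g \<in> carrier G \<and> g \<otimes> g \<noteq> y" for g unfolding M_def using R by blast
  define V where "V = {\<one>, x, y, x \<otimes> y}"
  have xyne: "x \<otimes> y \<noteq> \<one>" "x \<otimes> y \<noteq> x" "x \<otimes> y \<noteq> y"
  proof -
    show "x \<otimes> y \<noteq> \<one>" using gyy[OF x(1)] xy y by auto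
    show "x \<otimes> y \<noteq> x" using xxg[OF y(1)] xx y1 by auto
    show "x \<otimes> y \<noteq> y" using gyy[OF x(1)] yy x1 by auto
  qed
  have cV: "card V = 4" unfolding V_def using x1 y1 xy xyne by auto
  have Vc: "V \<subseteq> carrier G" unfolding V_def using x y by auto
  have xyxy: "x \<otimes> y \<otimes> (x \<otimes> y) = \<one>"
  proof -
    have "x \<otimes> y \<otimes> (x \<otimes> y) = x \<otimes> y \<otimes> (y \<otimes> x)" using xyc by simp
    also have "\<dots> = x \<otimes> (y \<otimes> y) \<otimes> x" using x y by (simp add: m_assoc)
    finally show ?thesis using yy xx x by simp
  qed
  have VM: "V \<subseteq> M" using xx yy xyxy y1 x y by (auto simp: V_def M)
  have Vx: "x \<otimes> g \<in> V" if "g \<in> V" for g using that xx xxg y x unfolding V_def by auto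
  have Vx': "g \<in> V" if "x \<otimes> g \<in> V" "g \<in> carrier G" for g using Vx[OF that(1)] xxg[OF that(2)] by simp
  have finM: "finite M" unfolding M_def using fin by simp
  have "card M = order G - card ?R"
    unfolding M_def order_def using card_Diff_subset[of ?R "carrier G"] fin by auto
  then have cM: "card M = 6" using o r by simp
  have "card (M - V) = 2" using card_Diff_subset[OF _ VM] finite_subset[OF VM finM] cM cV by simp
  then have "M - V \<noteq> {}" by (intro notI) simp
  then obtain s where s: "s \<in> M" "s \<notin> V" by blast
  have sc: "s \<in> carrier G" using s M by blast
  have sy: "s \<otimes> y \<in> M" "s \<otimes> y \<notin> V" "s \<otimes> y \<noteq> s"
  proof -
    have "s \<otimes> y \<otimes> (s \<otimes> y) = s \<otimes> y \<otimes> (y \<otimes> s)" using cen sc by simp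
    also have "\<dots> = s \<otimes> (y \<otimes> y) \<otimes> s" using sc y by (simp add: m_assoc)
    finally have "s \<otimes> y \<otimes> (s \<otimes> y) = s \<otimes> s" using yy sc by simp
    then show "s \<otimes> y \<in> M" using s(1) sc y M by simp
    have "g \<otimes> y \<in> V" if "g \<in> V" for g
      using that yy gyy[OF x(1)] x y unfolding V_def by auto
    from this[of "s \<otimes> y"] show "s \<otimes> y \<notin> V" using s(2) gyy[OF sc] by auto
    show "s \<otimes> y \<noteq> s" using sc y y1 by simp
  qed
  have "insert s (insert (s \<otimes> y) V) = M"
  proof (rule card_subset_eq[OF finM])
    show "insert s (insert (s \<otimes> y) V) \<subseteq> M" using s sy VM by simp
    show "card (insert s (insert (s \<otimes> y) V)) = card M"
      using s sy cV cM finite_subset[OF VM finM] by simp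
  qed
  then have Mcases: "g \<in> V \<or> g = s \<or> g = s \<otimes> y" if "g \<in> M" for g using that by blast
  have commutes: "x \<otimes> g = g \<otimes> x" if g: "g \<in> ?R" and xg: "x \<otimes> g \<in> ?R" for g
  proof -
    have gc: "g \<in> carrier G" using g by simp
    have "x \<otimes> g \<otimes> (x \<otimes> g) = g \<otimes> g" using g xg R by simp
    then have "(x \<otimes> g \<otimes> x) \<otimes> g = g \<otimes> g" using gc x by (simp add: m_assoc)
    then have "x \<otimes> g \<otimes> x = g" using right_cancel[of g "x \<otimes> g \<otimes> x" g] gc x by simp
    then have "g \<otimes> x = x \<otimes> g \<otimes> x \<otimes> x" by simp
    also have "\<dots> = x \<otimes> g" using gc x xx by (simp add: m_assoc)
    finally show ?thesis by simp
  qed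
  let ?A = "{g \<in> ?R. x \<otimes> g \<in> ?R}"
  have "?R - ?A \<subseteq> {x \<otimes> s, x \<otimes> (s \<otimes> y)}"
  proof
    fix g assume "g \<in> ?R - ?A"
    then have g: "g \<in> ?R" "x \<otimes> g \<notin> ?R" by blast+
    have gc: "g \<in> carrier G" using g(1) by simp
    have "x \<otimes> g \<in> M" unfolding M_def using g gc x by simp
    moreover have "x \<otimes> g \<notin> V"
    proof
      assume "x \<otimes> g \<in> V"
      then have "g \<in> M" using Vx' gc VM by blast
      then show False using g(1) unfolding M_def by blast
    qed
    ultimately have "x \<otimes> g = s \<or> x \<otimes> g = s \<otimes> y" using Mcases by blast
    then show "g \<in> {x \<otimes> s, x \<otimes> (s \<otimes> y)}" using xxg[OF gc] by auto
  qed
  then have "card (?R - ?A) \<le> card {x \<otimes> s, x \<otimes> (s \<otimes> y)}" by (intro card_mono) auto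
  also have "\<dots> \<le> 2" by (simp add: card_insert_if)
  finally have c2: "card (?R - ?A) \<le> 2" .
  have finR: "finite ?R" using fin by simp
  have AR: "?A \<subseteq> ?R" by blast
  have finA: "finite ?A" by (rule finite_subset[OF AR finR])
  have "card (?R - ?A) = card ?R - card ?A" by (rule card_Diff_subset[OF finA AR])
  then have cA: "card ?A \<ge> 8" using r c2 by linarith
  have AV: "?A \<inter> V = {}" using VM unfolding M_def by blast
  have "?A \<union> V \<subseteq> centralizer_of x"
  proof
    fix g assume "g \<in> ?A \<union> V"
    then have "g \<in> carrier G \<and> x \<otimes> g = g \<otimes> x"
    proof
      assume "g \<in> ?A"
      then show ?thesis using commutes by blast
    next
      assume "g \<in> V"
      have "x \<otimes> (x \<otimes> y) = y" using xxg y by simp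
      moreover have "x \<otimes> y \<otimes> x = y" using xyc x y xx by (simp add: m_assoc)
      ultimately have "x \<otimes> (x \<otimes> y) = x \<otimes> y \<otimes> x" by simp
      then show ?thesis using \<open>g \<in> V\<close> xyc x y unfolding V_def by (elim insertE emptyE) simp_all
    qed
    then show "g \<in> centralizer_of x" by (simp add: centralizer_of_def)
  qed
  then have "card (?A \<union> V) \<le> card (centralizer_of x)" by (rule card_mono[OF finite_centralizer_of(1)[OF fin]])
  moreover have "card (?A \<union> V) = card ?A + 4"
    using card_Un_disjoint[OF finA finite_subset[OF Vc fin] AV] cV by simp
  ultimately have "12 \<le> card (centralizer_of x)" using cA by linarith
  moreover have "card (centralizer_of x) dvd 16" using card_centralizer_dvd[OF x(1)] o by simp
  ultimately have "card (centralizer_of x) = 16"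
    by (intro dvd_eq_if_less_double) simp_all
  then have "centralizer_of x = carrier G" using centralizer_of_full[OF fin] o by simp
  then have "s \<in> centralizer_of x" using sc by simp
  then have xs: "x \<otimes> s = s \<otimes> x" by (simp add: centralizer_of_def)
  have "x \<otimes> s \<otimes> (x \<otimes> s) = s \<otimes> x \<otimes> (x \<otimes> s)" by (simp only: xs)
  also have "\<dots> = s \<otimes> (x \<otimes> (x \<otimes> s))" using x sc by (simp add: m_assoc)
  also have "\<dots> = s \<otimes> s" using xxg[OF sc] by simp
  finally have "x \<otimes> s \<in> M" using s(1) sc x M by simp
  moreover have "x \<otimes> s \<notin> V" using Vx' s sc by blast
  ultimately have "x \<otimes> s = s \<or> x \<otimes> s = s \<otimes> y" using Mcases by blast
  then show False
  proof
    assume "x \<otimes> s = s"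
    then show False using x1 x sc by simp
  next
    assume "x \<otimes> s = s \<otimes> y"
    then have "x \<otimes> s = y \<otimes> s" using cen sc by simp
    then show False using xy x y sc by simp
  qed
qed

text \<open>
  Let \<open>c\<close> have order 3, and let \<open>m\<close> be the number of square roots of \<open>y\<close> that commute with \<open>c\<close>.
  Conjugation by \<open>c\<close> gives \<open>m \<equiv> 10\<close> modulo 3 and multiplication by \<open>y\<close> shows that \<open>m\<close> is even, so
  \<open>m \<ge> 4\<close>. The \<open>3m\<close> products \<open>u c\<^sup>i\<close> are distinct and different from 1, hence the centraliser of \<open>c\<close> has
  more than 12 elements and is the whole group. Then \<open>m = 10\<close>, and \<open>3m\<close> is too large.
\<close>
lemma order_24_root_count_ne_10:
  assumes fin: "finite (carrier G)" and o: "order G = 24"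
    and y: "y \<in> carrier G" "ord y = 2" and cen: "\<forall>g\<in>carrier G. g \<otimes> y = y \<otimes> g"
  shows "card (roots 2 y) \<noteq> 10"
proof
  assume r: "card (roots 2 y) = 10"
  let ?R = "roots 2 y"
  have yy: "y \<otimes> y = \<one>" using pow_ord_eq_1[OF y(1)] y by (simp add: numeral_2_eq_2)
  have y2: "y [^] (2::nat) = \<one>" using pow_ord_eq_1[OF y(1)] y by simp
  have y1: "y \<noteq> \<one>" using y by auto
  have p3: "Factorial_Ring.prime (3::nat)" by simp
  obtain c where c: "c \<in> carrier G" "ord c = 3" using exists_element_of_prime_order[OF fin p3] o by auto
  have c3: "c [^] (3::nat) = \<one>" using pow_ord_eq_1[OF c(1)] c by simp
  let ?RF = "{u \<in> ?R. u \<otimes> c = c \<otimes> u}"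
  have finR: "finite ?R" using fin by simp
  have "card ?R mod 3 = card ?RF mod 3"
    by (rule square_roots_cong_centralised[OF fin p3 c(1) c3 y(1)]) (use cen c in simp)
  then have m3: "card ?RF mod 3 = 1" using r by simp
  have "card ?RF mod 2 = card {u \<in> ?RF. u \<otimes> y = u} mod 2"
  proof (rule card_fixed_points_cong_prime[OF two_is_prime_nat])
    show "finite ?RF" by (rule finite_subset[OF _ finR]) blast
    fix u assume "u \<in> ?RF"
    then have u: "u \<in> carrier G" "u [^] (2::nat) = y" "u \<otimes> c = c \<otimes> u" by auto
    have "u \<otimes> y = y \<otimes> u" using cen u(1) by blast
    from pow_mult_distrib[OF this u(1) y(1), of 2]
    have "(u \<otimes> y) [^] (2::nat) = y" using u(2) y2 y(1) by simp
    moreover have "u \<otimes> y \<otimes> c = c \<otimes> (u \<otimes> y)"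
    proof -
      have "c \<otimes> y = y \<otimes> c" using cen c(1) by blast
      then have "u \<otimes> y \<otimes> c = u \<otimes> (c \<otimes> y)" using u(1) c(1) y(1) by (simp add: m_assoc)
      also have "\<dots> = c \<otimes> u \<otimes> y" using u(1) c(1) y(1) by (simp flip: m_assoc u(3))
      finally show ?thesis using u(1) c(1) y(1) by (simp add: m_assoc)
    qed
    ultimately show "u \<otimes> y \<in> ?RF" using u y by simp
    show "((\<lambda>u. u \<otimes> y) ^^ 2) u = u" using u y yy by (simp add: numeral_2_eq_2 m_assoc)
  qed
  moreover have "{u \<in> ?RF. u \<otimes> y = u} = {}" using y y1 by auto
  ultimately have m2: "card ?RF mod 2 = 0" by (simp only: card.empty mod_0)
  have m4: "card ?RF \<ge> 4" using m2 m3 by presburger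
  let ?f = "\<lambda>(u, i::nat). u \<otimes> c [^] i" and ?D = "?RF \<times> {..<3::nat}"
  have cube: "(u \<otimes> c [^] i) [^] (3::nat) = u \<otimes> y" if "u \<in> ?RF" for u and i :: nat
  proof -
    have u: "u \<in> carrier G" "u [^] (2::nat) = y" "u \<otimes> c = c \<otimes> u" using that by auto
    have "u \<otimes> c [^] i = c [^] i \<otimes> u" using pow_commute[OF c(1) u(1) u(3)[symmetric], of i] by simp
    then have "(u \<otimes> c [^] i) [^] (3::nat) = u [^] (3::nat) \<otimes> (c [^] i) [^] (3::nat)"
      using pow_mult_distrib[of u "c [^] i" 3] u c by simp
    also have "(c [^] i) [^] (3::nat) = (c [^] (3::nat)) [^] i"
      using nat_pow_pow[OF c(1), of i 3] nat_pow_pow[OF c(1), of 3 i] by (simp add: mult.commute)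
    also have "u [^] (3::nat) = u \<otimes> y" using u nat_pow_Suc2[OF u(1), of 2] by (simp add: numeral_3_eq_3 numeral_2_eq_2)
    finally show ?thesis using c3 u y by simp
  qed
  have inj: "inj_on ?f ?D"
  proof (rule inj_onI)
    fix a b assume ab: "a \<in> ?D" "b \<in> ?D" "?f a = ?f b"
    obtain u i where a: "a = (u, i)" by (cases a)
    obtain v j where b: "b = (v, j)" by (cases b)
    have uv: "u \<in> ?RF" "v \<in> ?RF" "i < 3" "j < 3" using ab a b by simp_all
    have eq: "u \<otimes> c [^] i = v \<otimes> c [^] j" using ab(3) a b by simp
    have "u \<otimes> y = v \<otimes> y" using cube[OF uv(1), of i] cube[OF uv(2), of j] eq by simp
    then have e: "u = v" using right_cancel[OF y(1), of u v] uv by simp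
    then have "c [^] i = c [^] j" using eq uv(2) c by simp
    then have "i = j" using uv pow_eq_iff_mod[OF c(1), of i j] c by simp
    then show "a = b" using e a b by simp
  qed
  have CF: "subgroup (centralizer_of c) G" by (rule subgroup_centralizer_of[OF c(1)])
  have im: "?f ` ?D \<subseteq> centralizer_of c"
  proof (rule image_subsetI)
    fix a assume a: "a \<in> ?D"
    obtain u i where ui: "a = (u, i)" by (cases a)
    have "u \<in> centralizer_of c" using a ui by (simp add: centralizer_of_def)
    moreover have "c [^] i \<in> centralizer_of c" using pow_commute[OF c(1) c(1) refl, of i] c by (simp add: centralizer_of_def)
    ultimately have "u \<otimes> c [^] i \<in> centralizer_of c" by (rule subgroup.m_closed[OF CF])
    then show "?f a \<in> centralizer_of c" using ui by simp
  qed
  have one: "\<one> \<notin> ?f ` ?D"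
  proof
    assume "\<one> \<in> ?f ` ?D"
    then obtain a where a: "a \<in> ?D" "\<one> = ?f a" by blast
    obtain u i where ui: "a = (u, i)" by (cases a)
    have u: "u \<in> ?RF" "u \<otimes> c [^] i = \<one>" using a ui by simp_all
    have uy: "u \<otimes> y = \<one>" using cube[OF u(1), of i] u(2) by simp
    have uc: "u \<in> carrier G" "u [^] (2::nat) = y" using u by simp_all
    have "u = y" using uy yy right_cancel[OF y(1) uc(1) y(1)] by simp
    then show False using uc yy y1 by (simp add: numeral_2_eq_2)
  qed
  have cim: "card (?f ` ?D) = 3 * card ?RF" using card_image[OF inj] by (simp add: card_cartesian_product)
  have fC: "finite (centralizer_of c)" by (rule finite_centralizer_of(1)[OF fin])
  have "card (insert \<one> (?f ` ?D)) \<le> card (centralizer_of c)"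
    by (rule card_mono[OF fC]) (use im subgroup.one_closed[OF CF] in blast)
  then have big: "3 * card ?RF + 1 \<le> card (centralizer_of c)"
    using one cim finite_subset[OF im fC] by simp
  have "card (centralizer_of c) dvd 24" using card_centralizer_dvd[OF c(1)] o by simp
  moreover have "13 \<le> card (centralizer_of c)" using big m4 by linarith
  ultimately have c24: "card (centralizer_of c) = 24"
    by (intro dvd_eq_if_less_double) simp_all
  then have full: "centralizer_of c = carrier G" using centralizer_of_full[OF fin] o by simp
  have "?RF = ?R"
  proof
    show "?R \<subseteq> ?RF"
    proof
      fix u assume u: "u \<in> ?R"
      then have "u \<in> centralizer_of c" using full by simp
      then show "u \<in> ?RF" using u by (simp add: centralizer_of_def)
    qed
  qed blast
  then show False using big c24 r by simp
qed

end

section \<open>Gaps between square-root counts in small groups\<close>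

lemma even_cong_gap:
  fixes a b p :: nat
  assumes "a < b" "even a" "even b" "odd p" "a mod p = b mod p"
  shows "a + 2 * p \<le> b"
proof -
  have "p dvd b - a" using assms(1,5) mod_eq_dvd_iff_nat[of a b p] by simp
  moreover have "2 dvd b - a" using assms(1-3) by simp
  moreover have "coprime 2 p" using assms(4) by simp
  ultimately have "2 * p dvd b - a" by (intro divides_mult)
  then have "2 * p \<le> b - a" using assms(1) by (intro dvd_imp_le) simp_all
  then show ?thesis using assms(1) by linarith
qed

context group
begin

text \<open>
  Either alternative makes \<open>c\<^sup>8\<close> trivial. The alternatives are those of \<open>even_order_root_bound\<close> for a
  centraliser that consists of the forced elements only.
\<close>
lemma no_order_3_in_cyclic_or_roots:
  assumes y: "y \<in> carrier G" "ord y dvd 4" and c: "c \<in> carrier G" "ord c = 3"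
    and h: "(\<exists>i::nat. c = y [^] i) \<or> (\<exists>i::nat. c [^] (2::nat) = y [^] (2 * i + 1))"
  shows False
proof -
  have "c [^] (8::nat) = \<one>"
    using h
  proof
    assume "\<exists>i::nat. c = y [^] i"
    then obtain i :: nat where "c = y [^] i" by blast
    then have "c [^] (8::nat) = y [^] (i * 8)" using y by (simp add: nat_pow_pow)
    moreover have "ord y dvd i * 8" using y(2) dvd_trans[of "ord y" 4 "i * 8"] by simp
    ultimately show ?thesis using pow_eq_id[OF y(1)] by simp
  next
    assume "\<exists>i::nat. c [^] (2::nat) = y [^] (2 * i + 1)"
    then obtain i :: nat where i: "c [^] (2::nat) = y [^] (2 * i + 1)" by blast
    have "c [^] (8::nat) = (c [^] (2::nat)) [^] (4::nat)" using nat_pow_pow[OF c(1), of 2 4] by simp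
    also have "\<dots> = y [^] ((2 * i + 1) * 4)" unfolding i by (rule nat_pow_pow[OF y(1)])
    finally have "c [^] (8::nat) = y [^] ((2 * i + 1) * 4)" .
    moreover have "ord y dvd (2 * i + 1) * 4" using y(2) by (rule dvd_mult)
    ultimately show ?thesis using pow_eq_id[OF y(1)] by simp
  qed
  then have "3 dvd (8::nat)" using pow_eq_id[OF c(1)] c(2) by simp
  then show False by simp
qed

text \<open>
  An element of odd order has a square root in its own cyclic group, so \<open>x\<close> has at least one square
  root and \<open>y\<close> at least \<open>p + 1\<close>, and the order of the group is at least \<open>n(p + 1)\<close>. As two square
  roots of \<open>y\<close> produce an involution, the order is also even. Only \<open>n = 3\<close>, \<open>p = 5\<close> and the orders 18
  and 24 remain. In order 24 the groups generated by \<open>x\<close> and by \<open>y\<close> are Sylow subgroups. In order 18 every element would be a product \<open>u y\<^sup>i\<close>, and those whose ninth power is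
  trivial would lie in \<open>\<langle>y\<rangle>\<close>, which leaves no room for a subgroup of order 9.
\<close>
lemma no_root_gap_odd:
  assumes fin: "finite (carrier G)" and x: "x \<in> carrier G" and y: "y \<in> carrier G"
    and ordx: "ord x = n" and ordy: "ord y = n" and odd: "odd n"
    and less: "root_count G 2 x < root_count G 2 y"
    and cong: "root_count G 2 x mod p = root_count G 2 y mod p"
    and pn: "\<not> p dvd order G"
    and bounds: "p = 3 \<and> order G \<le> 15 \<or> p = 5 \<and> order G \<le> 31"
  shows False
proof -
  let ?C = "centralizer_of y"
  have noconj: False if "z \<in> carrier G" "z \<otimes> x \<otimes> inv z = y [^] (k::nat)" for z k
    using root_count_eq_if_conj_cyclic[OF fin x y _ that, of 2] ordx ordy less by simp
  have n_dvd: "n dvd order G" using ord_dvd_group_order[OF x] ordx by simp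
  have o0: "order G > 0" using fin order_gt_0_iff_finite by blast
  have n0: "n \<noteq> 0" using odd by (intro notI) simp
  have n1: "n \<noteq> 1"
  proof
    assume "n = 1"
    then have "x = \<one>" "y = \<one>" using ord_eq_1[OF x] ord_eq_1[OF y] ordx ordy by simp_all
    then show False using less by simp
  qed
  have pnn: "\<not> p dvd n" using pn n_dvd dvd_trans by blast
  obtain m where m: "n = 2 * m + 1" using odd oddE by blast
  have "x [^] (m + 1) \<in> roots 2 x"
  proof -
    have "(x [^] (m + 1)) [^] (2::nat) = x [^] (n + 1)" using nat_pow_pow[OF x, of "m + 1" 2] m by (simp add: algebra_simps)
    also have "\<dots> = x [^] n \<otimes> x" using x by simp
    also have "x [^] n = \<one>" using pow_ord_eq_1[OF x] ordx by simp
    finally show ?thesis using x by simp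
  qed
  then have rx: "root_count G 2 x \<ge> 1"
    unfolding root_count_def using fin by (simp add: Suc_le_eq card_gt_0_iff) blast
  have "p dvd root_count G 2 y - root_count G 2 x"
    using cong less mod_eq_dvd_iff_nat[of "root_count G 2 x" "root_count G 2 y" p] by simp
  then have "p \<le> root_count G 2 y - root_count G 2 x" using less by (intro dvd_imp_le) auto
  then have ry: "root_count G 2 y \<ge> p + 1" using rx less by arith
  have oddy: "odd (ord y)" using odd ordy by simp
  have bnd: "n * root_count G 2 y \<le> card ?C" using odd_order_root_bound(1)[OF fin y oddy] ordy by simp
  have Cle: "card ?C \<le> order G" by (rule finite_centralizer_of(2)[OF fin])
  have "n * (p + 1) \<le> n * root_count G 2 y" using ry by (rule mult_le_mono2)
  then have np: "n * (p + 1) \<le> order G" using bnd Cle by linarith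
  from bounds show False
  proof
    assume p3: "p = 3 \<and> order G \<le> 15"
    then have "n * 4 \<le> 15" using np by simp
    then have "n \<le> 3" by linarith
    then have "n = 3" using odd n1 n0 by (cases "n = 2") auto
    then show False using pnn p3 by simp
  next
    assume p5: "p = 5 \<and> order G \<le> 31"
    then have "n * 6 \<le> 31" using np by simp
    then have "n \<le> 5" by linarith
    moreover have "n \<noteq> 5" using pnn p5 by auto
    moreover have "n \<noteq> 2" "n \<noteq> 4" using odd by auto
    ultimately have n3: "n = 3" using n1 n0 by linarith
    have ry6: "root_count G 2 y \<ge> 6" using ry p5 by simp
    have bnd3: "3 * root_count G 2 y \<le> card ?C" using bnd n3 by simp
    then have C18: "card ?C \<ge> 18" using ry6 by linarith
    have CG: "card ?C = order G"
      by (rule dvd_eq_if_less_double[OF card_centralizer_dvd[OF y] o0]) (use C18 p5 in linarith)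
    have "roots 2 y - {y [^] (2::nat)} \<noteq> {}"
    proof
      assume "roots 2 y - {y [^] (2::nat)} = {}"
      then have "roots 2 y \<subseteq> {y [^] (2::nat)}" by blast
      then have "card (roots 2 y) \<le> card {y [^] (2::nat)}" by (rule card_mono[rotated]) simp
      then show False using ry6 by (simp add: root_count_def)
    qed
    then obtain u where u: "u \<in> roots 2 y" "u \<noteq> y [^] (2::nat)" by blast
    have uc: "u \<in> carrier G" using u by simp
    have y3: "y [^] (3::nat) = \<one>" using pow_ord_eq_1[OF y] ordy n3 by simp
    have "(u \<otimes> y) [^] (2::nat) = y [^] (2 * 1 + 1 :: nat)"
      using inj_on_root_pow(3)[OF y _ u(1), of 0 1] y by simp
    then have "(u \<otimes> y) [^] (2::nat) = \<one>" using y3 by simp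
    then have d2: "ord (u \<otimes> y) dvd 2" using pow_eq_id[of "u \<otimes> y" 2] uc y by simp
    have "u \<otimes> y \<noteq> \<one>"
    proof
      assume a: "u \<otimes> y = \<one>"
      have "y [^] (2::nat) \<otimes> y = \<one>" using y3 by (simp add: numeral_3_eq_3 numeral_2_eq_2)
      then have "u \<otimes> y = y [^] (2::nat) \<otimes> y" using a by simp
      then show False using u(2) uc y by simp
    qed
    then have "ord (u \<otimes> y) \<noteq> 1" using ord_eq_1[of "u \<otimes> y"] uc y by simp
    then have "ord (u \<otimes> y) = 2" using d2 two_is_prime_nat unfolding prime_nat_iff by blast
    then have even: "2 dvd order G" using ord_dvd_group_order[of "u \<otimes> y"] uc y by simp
    have "3 dvd order G" using n_dvd n3 by simp
    moreover have "\<not> 5 dvd order G" using pn p5 by simp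
    ultimately have "order G = 18 \<or> order G = 24" using even C18 CG p5 by presburger
    then show False
    proof
      assume o24: "order G = 24"
      let ?S = "generate G {y}"
      have S: "subgroup ?S G" using y by (intro generate_is_subgroup) auto
      have "card ?S = 3" using generate_pow_card[OF y] ordy n3 by simp
      then have nd: "\<not> 3 dvd order G div card ?S" using o24 by simp
      have x3: "x [^] (3 ^ 1 :: nat) = \<one>" using pow_ord_eq_1[OF x] ordx n3 by simp
      have p3: "Factorial_Ring.prime (3::nat)" by simp
      obtain z where z: "z \<in> carrier G" "z \<otimes> x \<otimes> inv z \<in> ?S"
        using conj_into_Sylow[OF p3 fin S nd x x3] by blast
      then obtain k :: nat where "z \<otimes> x \<otimes> inv z = y [^] k" unfolding generate_singleton_eq_powers[OF fin y] by blast
      then show False using noconj z(1) by blast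
    next
      assume o18: "order G = 18"
      have "root_count G 2 y = 6" using bnd3 CG o18 ry6 by linarith
      then have eq: "ord y * root_count G 2 y = card ?C" using ordy n3 CG o18 by simp
      have full: "?C = carrier G" by (rule centralizer_of_full[OF fin CG])
      have "order G = 3 ^ 2 * 2" using o18 by simp
      then obtain Q where Q: "subgroup Q G" "card Q = 3 ^ 2"
        using sylow_thm[of 3 G 2 2] is_group fin by auto
      have "Q \<subseteq> generate G {y}"
      proof
        fix q assume q: "q \<in> Q"
        have qc: "q \<in> carrier G" using subgroup.mem_carrier[OF Q(1) q] .
        interpret QG: group "G\<lparr>carrier := Q\<rparr>" by (rule subgroup_imp_group[OF Q(1)])
        have "QG.ord q dvd 9" using QG.ord_dvd_group_order[of q] q Q(2) by (simp add: order_def)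
        then have "q [^] (9::nat) = \<one>" using ord_subgroup[OF Q(1) q] pow_eq_id[OF qc] by simp
        then have q10: "q [^] (10::nat) = q" using nat_pow_mult[OF qc, of 9 1] qc by simp
        obtain u i where ui: "u \<in> roots 2 y" "q = u \<otimes> y [^] (i::nat)"
          using odd_order_root_bound(2)[OF fin y oddy eq, of q] full qc by blast
        \<comment> \<open>The square of \<open>q\<close> is a power of \<open>y\<close>, and \<open>q = q\<^bsup>10\<^esup>\<close> is a power of that square.\<close>
        have q2: "q [^] (2::nat) = y [^] (2 * i + 1)"
          using inj_on_root_pow(3)[OF y _ ui(1), of 0 i] ui(2) by simp
        have "(q [^] (2::nat)) [^] (5::nat) = y [^] ((2 * i + 1) * 5)" unfolding q2 by (rule nat_pow_pow[OF y])
        moreover have "(q [^] (2::nat)) [^] (5::nat) = q" using nat_pow_pow[OF qc, of 2 5] q10 by simp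
        ultimately show "q \<in> generate G {y}" unfolding generate_singleton_eq_powers[OF fin y] by simp
      qed
      moreover have "finite (generate G {y})"
        using finite_subset[OF generate_incl[of "{y}"] fin] y by simp
      ultimately have "card Q \<le> card (generate G {y})" by (intro card_mono)
      then show False using Q(2) generate_pow_card[OF y] ordy n3 by simp
    qed
  qed
qed

text \<open>
  The roots together with \<open>1\<close>, \<open>x\<close>, \<open>y\<close> make at least 13 elements, and the order is divisible by 4
  but not by 5, so it is 16, 24 or 28. In order 28 a square root of \<open>y\<close> generates a Sylow 2-subgroup,
  into which \<open>x\<close> can be conjugated. In the other two orders \<open>y\<close> is central and has exactly ten square
  roots, \<open>x\<close> none: in order 16 for lack of room, in order 24 because otherwise \<open>x\<close> and \<open>y\<close> would have
  conjugates that are squares in one Sylow subgroup of order 8, and so be conjugate.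
\<close>
lemma no_root_gap_involutions:
  assumes fin: "finite (carrier G)" and x: "x \<in> carrier G" "ord x = 2" and y: "y \<in> carrier G" "ord y = 2"
    and ge: "root_count G 2 x + 10 \<le> root_count G 2 y"
    and ev: "even (root_count G 2 x)"
    and cong: "root_count G 2 x mod 5 = root_count G 2 y mod 5"
    and o5: "\<not> 5 dvd order G" "order G \<le> 31"
  shows False
proof -
  let ?C = "centralizer_of y" and ?rx = "root_count G 2 x" and ?ry = "root_count G 2 y"
  have noconj: False if "z \<in> carrier G" "z \<otimes> x \<otimes> inv z = y [^] (k::nat)" for z k
    using root_count_eq_if_conj_cyclic[OF fin x(1) y(1) _ that, of 2] x y ge by simp
  have o0: "order G > 0" using fin order_gt_0_iff_finite by blast
  have finr: "finite (roots 2 g)" for g using fin by simp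
  have p2: "Factorial_Ring.prime (2::nat)" by (rule two_is_prime_nat)
  have sq1: "x [^] (2::nat) = \<one>" "y [^] (2::nat) = \<one>"
    using pow_ord_eq_1[OF x(1)] pow_ord_eq_1[OF y(1)] x y by simp_all
  have ne: "x \<noteq> \<one>" "y \<noteq> \<one>" "x \<noteq> y" using x y ge by auto
  have cT: "card {\<one>, x, y} = 3" using ne by auto
  have "roots 2 x \<inter> roots 2 y = {}" using ne by auto
  then have cU: "card (roots 2 x \<union> roots 2 y) = ?rx + ?ry"
    using card_Un_disjoint[OF finr finr] by (simp add: root_count_def)
  have dT: "(roots 2 x \<union> roots 2 y) \<inter> {\<one>, x, y} = {}" using sq1 ne by auto
  have "card (roots 2 x \<union> roots 2 y \<union> {\<one>, x, y}) = ?rx + ?ry + 3"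
    using card_Un_disjoint[OF _ _ dT] finr cU cT by simp
  moreover have "card (roots 2 x \<union> roots 2 y \<union> {\<one>, x, y}) \<le> order G"
    unfolding order_def by (rule card_mono[OF fin]) (use x y in auto)
  ultimately have total: "?rx + ?ry + 3 \<le> order G" by linarith
  have "roots 2 y \<noteq> {}"
  proof
    assume "roots 2 y = {}"
    then have "?ry = 0" unfolding root_count_def by (simp only: card.empty)
    then show False using ge by simp
  qed
  then obtain u where u: "u \<in> carrier G" "u [^] (2::nat) = y" by blast
  have ordu: "ord u = 4" using ord_prime_root[OF p2 u] y by simp
  then have "4 dvd order G" using ord_dvd_group_order[OF u(1)] by simp
  then have orders: "order G = 16 \<or> order G = 24 \<or> order G = 28"
    using total ge o5 by presburger
  have bnd: "?ry + 2 \<le> card ?C" using even_order_root_bound(1)[OF fin y(1), of 1] y by simp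
  have Cdvd: "card ?C dvd order G" by (rule card_centralizer_dvd[OF y(1)])
  have central: "\<forall>g\<in>carrier G. g \<otimes> y = y \<otimes> g" if "order G < 2 * card ?C"
  proof -
    have "?C = carrier G"
      by (rule centralizer_of_full[OF fin dvd_eq_if_less_double[OF Cdvd o0 that]])
    then show ?thesis unfolding centralizer_of_def by blast
  qed
  from orders show False
  proof (elim disjE)
    assume o16: "order G = 16"
    have "?rx \<le> 1" using total ge o16 by linarith
    then have "?rx = 0" using ev by presburger
    then have "?ry = 10" using total ge o16 cong by presburger
    moreover have "\<forall>g\<in>carrier G. g \<otimes> y = y \<otimes> g" by (rule central) (use bnd ge o16 in linarith)
    ultimately show False
      using order_16_root_count_ne_10[OF fin o16 x y ne(3)] by (simp add: root_count_def)
  next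
    assume o28: "order G = 28"
    let ?S = "generate G {u}"
    have S: "subgroup ?S G" using u by (intro generate_is_subgroup) auto
    have "card ?S = 4" using generate_pow_card[OF u(1)] ordu by simp
    then have nd: "\<not> 2 dvd order G div card ?S" using o28 by simp
    have x2: "x [^] (2 ^ 1 :: nat) = \<one>" using sq1 by simp
    obtain z where z: "z \<in> carrier G" "z \<otimes> x \<otimes> inv z \<in> ?S"
      using conj_into_Sylow[OF p2 fin S nd x(1) x2] by blast
    then obtain i :: nat where i: "z \<otimes> x \<otimes> inv z = u [^] i" unfolding generate_singleton_eq_powers[OF fin u(1)] by blast
    have "(z \<otimes> x \<otimes> inv z) [^] (2::nat) = \<one>" using conj_pow[OF z(1) x(1), of 2] sq1 z by simp
    then have "u [^] (i * 2) = \<one>" using i nat_pow_pow[OF u(1), of i 2] by simp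
    then have "4 dvd i * 2" using pow_eq_id[OF u(1)] ordu by simp
    then have "2 dvd i" by presburger
    then obtain j where "i = 2 * j" by blast
    then have "z \<otimes> x \<otimes> inv z = y [^] j" using i nat_pow_pow[OF u(1), of 2 j] u(2) by simp
    then show False using noconj z(1) by blast
  next
    assume o24: "order G = 24"
    have p3: "Factorial_Ring.prime (3::nat)" by simp
    have y4: "ord y dvd 4" using y by simp
    have "card ?C \<noteq> 12"
    proof
      assume C12: "card ?C = 12"
      then have eq: "1 * ?ry + 2 * 1 = card ?C" using bnd ge by linarith
      have y2: "ord y = 2 * 1" using y by simp
      have C: "subgroup ?C G" by (rule subgroup_centralizer_of[OF y(1)])
      interpret CG: group "G\<lparr>carrier := ?C\<rparr>" by (rule subgroup_imp_group[OF C])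
      have "order (G\<lparr>carrier := ?C\<rparr>) = 12" using C12 by (simp add: order_def)
      then obtain c where c: "c \<in> ?C" "CG.ord c = 3"
        using CG.exists_element_of_prime_order[OF _ p3] finite_centralizer_of(1)[OF fin] by auto
      have cc: "c \<in> carrier G" using subgroup.mem_carrier[OF C c(1)] .
      have oc: "ord c = 3" using ord_subgroup[OF C c(1)] c(2) by simp
      show False
        by (rule no_order_3_in_cyclic_or_roots[OF y(1) y4 cc oc even_order_root_bound(2)[OF fin y(1) y2 eq c(1)]])
    qed
    moreover have "12 \<le> card ?C" using bnd ge by linarith
    ultimately have cen: "\<forall>g\<in>carrier G. g \<otimes> y = y \<otimes> g" using central o24 by simp
    have "roots 2 x = {}"
    proof (rule ccontr)
      assume "roots 2 x \<noteq> {}"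
      then obtain a where a: "a \<in> carrier G" "a [^] (2::nat) = x" by blast
      have "multiplicity 2 (24::nat) = 3" by (rule multiplicity_eqI) auto
      moreover have "multiplicity 2 (2::nat) = 1" by (rule multiplicity_eqI) auto
      ultimately have m: "multiplicity 2 (order G) \<le> multiplicity 2 (ord x) + 2" using o24 x by simp
      have "\<exists>z\<in>carrier G. \<exists>k::nat. z \<otimes> x \<otimes> inv z = y [^] k"
      proof (rule conj_into_cyclic_subgroup[OF fin x(1) y(1)])
        show "ord x = ord y" using x y by simp
        fix q :: nat assume q: "Factorial_Ring.prime q" "q dvd ord x"
        then have "q = 2" using primes_dvd_imp_eq[OF q(1) p2] x by simp
        then show "multiplicity q (order G) \<le> multiplicity q (ord x) \<or>
          multiplicity q (order G) \<le> multiplicity q (ord x) + 2 \<and>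
          (\<exists>a\<in>carrier G. a [^] q = x) \<and> (\<exists>b\<in>carrier G. b [^] q = y)"
          using m a u by blast
      qed
      then show False using noconj by blast
    qed
    then have rx0: "?rx = 0" unfolding root_count_def by (simp only: card.empty)
    obtain c where c: "c \<in> carrier G" "ord c = 3" using exists_element_of_prime_order[OF fin p3] o24 by auto
    have c2: "c [^] (2::nat) \<in> carrier G" "ord (c [^] (2::nat)) = 3"
      using c ord_pow_gen[OF c(1), of 2] by simp_all
    have root_ord: "ord g = 4" if "g \<in> roots 2 y" for g
      using ord_prime_root[OF p2, of g y] that y by simp
    have cne: "c \<noteq> c [^] (2::nat)"
    proof
      assume "c = c [^] (2::nat)"
      then have "c \<otimes> c = c" using c by (simp add: numeral_2_eq_2)
      then have "c = \<one>" using c by simp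
      then show False using c by simp
    qed
    let ?T = "{\<one>, x, y, c, c [^] (2::nat)}"
    have "c \<noteq> \<one>" "c \<noteq> x" "c \<noteq> y" using c x y by auto
    moreover have "c [^] (2::nat) \<noteq> \<one>" "c [^] (2::nat) \<noteq> x" "c [^] (2::nat) \<noteq> y"
      using c2 x y by auto
    ultimately have cT5: "card ?T = 5" using ne cne by (simp add: card_insert_if)
    have ordT: "ord g \<noteq> 4" if "g \<in> ?T" for g
      using that x y c c2 by (elim insertE emptyE) simp_all
    have dT5: "roots 2 y \<inter> ?T = {}" using root_ord ordT by blast
    have "card (roots 2 y \<union> ?T) = card (roots 2 y) + card ?T"
      by (rule card_Un_disjoint[OF finr _ dT5]) simp
    moreover have "card (roots 2 y \<union> ?T) \<le> order G"
      unfolding order_def by (rule card_mono[OF fin]) (use x y c in auto)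
    ultimately have "?ry \<le> 19" using o24 cT5 unfolding root_count_def by linarith
    moreover have "even ?ry" using even_root_count[OF fin y(1)] y by simp
    ultimately have "?ry = 10" using rx0 ge cong by presburger
    then show False using order_24_root_count_ne_10[OF fin o24 y cen] by (simp add: root_count_def)
  qed
qed

text \<open>
  For even \<open>n\<close> both counts are even, which doubles the gap; together with \<open>even_order_root_bound\<close> this
  leaves \<open>n = 2\<close>, and \<open>n = 4\<close> in order 24. If \<open>n = 4\<close>, the bound is attained, and an element of order 3
  has no place. If \<open>n = 2\<close> and \<open>p = 3\<close>, there are at least nine elements, but no multiple of 4 between
  9 and 15 is prime to 3.
\<close>
lemma no_root_gap:
  assumes fin: "finite (carrier G)" and x: "x \<in> carrier G" and y: "y \<in> carrier G"
    and ordxy: "ord x = ord y"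
    and less: "root_count G 2 x < root_count G 2 y"
    and cong: "root_count G 2 x mod p = root_count G 2 y mod p"
    and pn: "\<not> p dvd order G"
    and bounds: "p = 3 \<and> order G \<le> 15 \<or> p = 5 \<and> order G \<le> 31"
  shows False
proof (cases "odd (ord x)")
  case True
  then show False using no_root_gap_odd[OF fin x y refl ordxy[symmetric] True less cong pn bounds] by simp
next
  case False
  let ?C = "centralizer_of y" and ?rx = "root_count G 2 x" and ?ry = "root_count G 2 y"
  have o0: "order G > 0" using fin order_gt_0_iff_finite by blast
  have ev: "even ?rx" "even ?ry" using even_root_count[OF fin] x y False ordxy by simp_all
  obtain m where m: "ord x = 2 * m" "ord y = 2 * m" using False ordxy by auto
  have m0: "m > 0" using m ord_ge_1[OF fin x] by simp
  have Cle: "card ?C \<le> order G" by (rule finite_centralizer_of(2)[OF fin])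
  have bnd: "m * ?ry + 2 * m \<le> order G" using even_order_root_bound(1)[OF fin y m(2)] Cle by linarith
  have "roots 2 y \<noteq> {}"
  proof
    assume "roots 2 y = {}"
    then have "?ry = 0" unfolding root_count_def by (simp only: card.empty)
    then show False using less by simp
  qed
  then obtain u where u: "u \<in> carrier G" "u [^] (2::nat) = y" by blast
  have ordu: "ord u = 4 * m" using ord_prime_root[OF two_is_prime_nat u] m by simp
  have four: "4 * m dvd order G" using ord_dvd_group_order[OF u(1)] ordu by simp
  from bounds show False
  proof
    assume p3: "p = 3 \<and> order G \<le> 15"
    have ge: "?rx + 6 \<le> ?ry" using even_cong_gap[OF less ev _ cong] p3 by simp
    have "m * 6 \<le> m * ?ry" using ge by (intro mult_le_mono2) linarith
    then have "m = 1" using bnd p3 m0 by linarith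
    then have ord2: "ord x = 2" "ord y = 2" using m by simp_all
    have ne: "x \<noteq> \<one>" "y \<noteq> \<one>" "x \<noteq> y" using ord2 less by auto
    have sq1: "x [^] (2::nat) = \<one>" "y [^] (2::nat) = \<one>"
      using pow_ord_eq_1[OF x] pow_ord_eq_1[OF y] ord2 by simp_all
    have cT: "card {\<one>, x, y} = 3" using ne by auto
    have dT: "roots 2 y \<inter> {\<one>, x, y} = {}" using sq1 ne by auto
    have "card (roots 2 y \<union> {\<one>, x, y}) = ?ry + 3"
      using card_Un_disjoint[OF _ _ dT] fin cT by (simp add: root_count_def)
    moreover have "card (roots 2 y \<union> {\<one>, x, y}) \<le> order G"
      unfolding order_def by (rule card_mono[OF fin]) (use x y in auto)
    ultimately have "9 \<le> order G" using ge by linarith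
    moreover have "4 dvd order G" using four \<open>m = 1\<close> by simp
    moreover have "\<not> 3 dvd order G" using pn p3 by simp
    ultimately show False using p3 by presburger
  next
    assume p5: "p = 5 \<and> order G \<le> 31"
    have ge: "?rx + 10 \<le> ?ry" using even_cong_gap[OF less ev _ cong] p5 by simp
    have mle: "m * 10 \<le> m * ?ry" using ge by (intro mult_le_mono2) linarith
    then have "m \<le> 2" using bnd p5 by linarith
    then consider "m = 1" | "m = 2" using m0 by linarith
    then show False
    proof cases
      case 1
      then show False
        using no_root_gap_involutions[OF fin x _ y _ ge ev(1)] m cong pn p5 by simp
    next
      case 2
      have "8 dvd order G" using four 2 by simp
      moreover have "24 \<le> order G" using bnd mle 2 by linarith
      ultimately have o24: "order G = 24" using p5 by presburger
      have "m * ?ry + 2 * m = card ?C"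
      proof -
        have "24 \<le> card ?C" using even_order_root_bound(1)[OF fin y m(2)] mle 2 by linarith
        then show ?thesis using bnd Cle o24 mle 2 by linarith
      qed
      note eq = this
      have "card ?C = order G" using eq bnd Cle o24 mle 2 by linarith
      then have full: "?C = carrier G" by (rule centralizer_of_full[OF fin])
      obtain c where c: "c \<in> carrier G" "ord c = 3"
        using exists_element_of_prime_order[OF fin, of 3] o24 by auto
      have y4: "ord y dvd 4" using m 2 by simp
      have cC: "c \<in> ?C" using full c(1) by simp
      show False
        by (rule no_order_3_in_cyclic_or_roots[OF y y4 c even_order_root_bound(2)[OF fin y m(2) eq cC]])
    qed
  qed
qed

end

section \<open>The bounds for p = 3 and p = 5\<close>

lemma multiplicity_le_if_not_dvd:
  fixes q N :: nat
  assumes "Factorial_Ring.prime q" "N \<noteq> 0" "\<not> q ^ Suc k dvd N"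
  shows "multiplicity q N \<le> k"
proof (rule ccontr)
  assume "\<not> ?thesis"
  then have "Suc k \<le> multiplicity q N" by simp
  then have "q ^ Suc k dvd N" by (rule multiplicity_dvd')
  then show False using assms(3) by simp
qed

context group
begin

text \<open>
  If \<open>q\<close> did not divide the order of \<open>u\<close>, then \<open>u\<close> would be a power of \<open>x\<close> and commute with \<open>g\<close>.
\<close>
lemma ord_root_if_noncommuting:
  assumes q: "Factorial_Ring.prime (q::nat)" and u: "u \<in> carrier G" "u [^] q = x"
    and g: "g \<in> carrier G" "g \<otimes> x = x \<otimes> g" "g \<otimes> u \<noteq> u \<otimes> g"
  shows "ord u = q * ord x"
proof -
  have q0: "q \<noteq> 0" using q by auto
  have xc: "x \<in> carrier G" using u by auto
  have x: "ord x = ord u div gcd (ord u) q" using ord_pow_gen[OF u(1), of q] u(2) q0 by simp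
  have "q dvd ord u"
  proof (rule ccontr)
    assume "\<not> q dvd ord u"
    then have "coprime q (ord u)" using q prime_imp_coprime by blast
    then obtain s t where st: "q * s = ord u * t + 1"
      using bezout_nat[of q "ord u"] q0 by (auto simp: coprime_iff_gcd_eq_1)
    have "u [^] (q * s) = u [^] (1::nat)"
      unfolding pow_eq_iff_mod[OF u(1)] st by (simp only: mod_mult_self4)
    then have "u = x [^] s" using nat_pow_pow[OF u(1), of q s] u by simp
    then have "u \<otimes> g = g \<otimes> u" using pow_commute[OF xc g(1) g(2)[symmetric], of s] by simp
    then show False using g(3) by simp
  qed
  then show ?thesis using x q0 by (simp add: gcd_nat.absorb2)
qed

text \<open>
  If every square root of \<open>x\<close> commuted with every \<open>p\<close>-th root, then \<open>x\<close> would have as many \<open>2p\<close>-th roots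
  as the two counts allow, and \<open>y\<close> could not have more. The two members of a pair that does not
  commute have orders \<open>2n\<close> and \<open>pn\<close>, where \<open>n\<close> is the order of \<open>x\<close>.
\<close>
lemma twice_prime_ord_dvd_order:
  assumes fin: "finite (carrier G)" and p: "Factorial_Ring.prime p" "odd p"
    and x: "x \<in> carrier G" and y: "y \<in> carrier G"
    and r2: "root_count G 2 x = root_count G 2 y" and rp: "root_count G p x = root_count G p y"
    and r2p: "root_count G (2 * p) x < root_count G (2 * p) y"
  shows "2 * p * ord x dvd order G" "\<exists>u\<in>carrier G. u [^] (2::nat) = x" "\<exists>v\<in>carrier G. v [^] p = x"
    "\<exists>u\<in>carrier G. u [^] (2::nat) = y" "\<exists>v\<in>carrier G. v [^] p = y"
proof -
  obtain k where k: "p = 2 * k + 1" using p(2) oddE by blast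
  let ?c = "\<lambda>g v. card {u \<in> roots 2 g. u \<otimes> v = v \<otimes> u}"
  have finr: "finite (roots l g)" for l g using fin by simp
  have sum_less: "(\<Sum>v\<in>roots p x. ?c x v) < (\<Sum>v\<in>roots p y. ?c y v)"
    using r2p root_count_double[OF fin k] by simp
  have "\<exists>v\<in>roots p x. \<exists>u\<in>roots 2 x. u \<otimes> v \<noteq> v \<otimes> u"
  proof (rule ccontr)
    assume "\<not> ?thesis"
    then have "{u \<in> roots 2 x. u \<otimes> v = v \<otimes> u} = roots 2 x" if "v \<in> roots p x" for v using that by blast
    then have "(\<Sum>v\<in>roots p x. ?c x v) = (\<Sum>v\<in>roots p x. card (roots 2 x))" by (intro sum.cong) simp_all
    then have all: "(\<Sum>v\<in>roots p x. ?c x v) = card (roots p x) * card (roots 2 x)" by simp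
    have le: "?c y v \<le> card (roots 2 y)" for v by (rule card_mono[OF finr]) blast
    have "(\<Sum>v\<in>roots p y. ?c y v) \<le> card (roots p y) * card (roots 2 y)"
      using sum_bounded_above[of "roots p y" "?c y" "card (roots 2 y)", OF le] by simp
    then show False using sum_less all r2 rp by (simp add: root_count_def)
  qed
  then obtain v u where v: "v \<in> carrier G" "v [^] p = x" and u: "u \<in> carrier G" "u [^] (2::nat) = x"
    and nc: "u \<otimes> v \<noteq> v \<otimes> u" by blast
  show "\<exists>u\<in>carrier G. u [^] (2::nat) = x" "\<exists>v\<in>carrier G. v [^] p = x" using u v by blast+
  have ux: "u \<otimes> x = x \<otimes> u" using pow_commute[OF u(1) u(1) refl, of 2] u(2) by simp
  have vx: "v \<otimes> x = x \<otimes> v" using pow_commute[OF v(1) v(1) refl, of p] v(2) by simp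
  have ordu: "ord u = 2 * ord x"
    by (rule ord_root_if_noncommuting[OF two_is_prime_nat u v(1) vx nc[symmetric]])
  have ordv: "ord v = p * ord x"
    by (rule ord_root_if_noncommuting[OF p(1) v u(1) ux nc])
  have d: "2 * ord x dvd order G" "p * ord x dvd order G"
    using ord_dvd_group_order[OF u(1)] ord_dvd_group_order[OF v(1)] ordu ordv by simp_all
  obtain N where N: "order G = ord x * N" using ord_dvd_group_order[OF x] by (rule dvdE)
  have n0: "ord x \<noteq> 0" using ord_ge_1[OF fin x] by simp
  have "2 dvd N" "p dvd N" using d n0 unfolding N by (simp_all add: mult.commute[of _ "ord x"])
  moreover have "coprime 2 p" using p(2) by simp
  ultimately have "2 * p dvd N" by (intro divides_mult)
  then show "2 * p * ord x dvd order G" unfolding N by (simp add: mult.commute[of "ord x"])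
  have nonempty: "roots l y \<noteq> {}" if g: "g \<in> roots l x" and eq: "root_count G l x = root_count G l y" for g l
  proof
    assume "roots l y = {}"
    then have "card (roots l x) = 0" using eq unfolding root_count_def by (simp only: card.empty)
    then have "roots l x = {}" using finr[of l x] by (simp only: card_0_eq)
    then show False using g by blast
  qed
  have "roots 2 y \<noteq> {}" using nonempty[OF _ r2, of u] u by simp
  moreover have "roots p y \<noteq> {}" using nonempty[OF _ rp, of v] v by simp
  ultimately show "\<exists>u\<in>carrier G. u [^] (2::nat) = y" "\<exists>v\<in>carrier G. v [^] p = y" by blast+
qed

text \<open>
  Writing the order as \<open>2p\<^sup>2t\<close> gives \<open>t \<le> 6\<close>, so neither \<open>2\<^sup>4\<close> nor \<open>p\<^sup>4\<close> nor the square of another prime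
  divides it. Since the order \<open>n\<close> of \<open>x\<close> divides \<open>pt\<close>, the hypotheses of \<open>conj_into_cyclic_subgroup\<close>
  hold for every prime divisor of \<open>n\<close>.
\<close>
lemma prime_square_not_dvd_order:
  assumes fin: "finite (carrier G)" and p: "Factorial_Ring.prime p"
    and bounds: "p = 3 \<and> order G < 96 \<or> p = 5 \<and> order G < 320"
    and x: "x \<in> carrier G" and y: "y \<in> carrier G" and ordxy: "ord x = ord y"
    and r2: "root_count G 2 x = root_count G 2 y" and rp: "root_count G p x = root_count G p y"
    and r2p: "root_count G (2 * p) x < root_count G (2 * p) y"
  shows "\<not> p\<^sup>2 dvd order G"
proof
  assume p2: "p\<^sup>2 dvd order G"
  have oddp: "odd p" using bounds by auto
  note roots = twice_prime_ord_dvd_order[OF fin p oddp x y r2 rp r2p]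
  have o0: "order G \<noteq> 0" using fin order_gt_0_iff_finite by simp
  have "2 dvd order G" using roots(1) by (meson dvd_mult_left)
  moreover have "coprime 2 (p\<^sup>2)" using oddp by simp
  ultimately have "2 * p\<^sup>2 dvd order G" using p2 by (intro divides_mult)
  then obtain t where t: "order G = 2 * p\<^sup>2 * t" by blast
  have p0: "p > 0" using p prime_gt_0_nat by blast
  have t0: "t > 0" using t o0 by (cases t) auto
  have tle: "t \<le> 6" using bounds t by auto
  have tcases: "t = 1 \<or> t = 2 \<or> t = 3 \<or> t = 4 \<or> t = 5 \<or> t = 6" using t0 tle by linarith
  have npt: "ord x dvd p * t"
  proof -
    have "(2 * p) * ord x dvd (2 * p) * (p * t)" using roots(1) t by (simp add: power2_eq_square mult.assoc)
    then show ?thesis using p0 by simp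
  qed
  have "\<exists>z\<in>carrier G. \<exists>k::nat. z \<otimes> x \<otimes> inv z = y [^] k"
  proof (rule conj_into_cyclic_subgroup[OF fin x y ordxy])
    fix q :: nat assume q: "Factorial_Ring.prime q" "q dvd ord x"
    have q1: "q > 1" using q(1) prime_gt_1_nat by blast
    have n0: "ord x \<noteq> 0" using ord_ge_1[OF fin x] by simp
    have ge1: "1 \<le> multiplicity q (ord x)"
      using multiplicity_gt_zero_iff[of "ord x" q] q(2) n0 q1 by simp
    consider "q = 2" | "q = p" "q \<noteq> 2" | "q \<noteq> 2" "q \<noteq> p" by blast
    then show "multiplicity q (order G) \<le> multiplicity q (ord x) \<or>
      multiplicity q (order G) \<le> multiplicity q (ord x) + 2 \<and>
      (\<exists>a\<in>carrier G. a [^] q = x) \<and> (\<exists>b\<in>carrier G. b [^] q = y)"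
    proof cases
      case 1
      have "\<not> q ^ Suc 3 dvd order G"
      proof
        assume "q ^ Suc 3 dvd order G"
        then have "16 dvd 2 * p\<^sup>2 * t" using 1 t by simp
        moreover have "p\<^sup>2 = 9 \<or> p\<^sup>2 = 25" using bounds by auto
        ultimately have "16 dvd 2 * 9 * t \<or> 16 dvd 2 * 25 * t"
          by (elim disjE) (simp_all add: mult.commute)
        then show False using tcases by auto
      qed
      then have "multiplicity q (order G) \<le> 3" by (rule multiplicity_le_if_not_dvd[OF q(1) o0])
      then have "multiplicity q (order G) \<le> multiplicity q (ord x) + 2" using ge1 by linarith
      then show ?thesis using 1 roots(2,4) by simp
    next
      case 2
      have "\<not> q ^ Suc 3 dvd order G"
      proof
        assume a: "q ^ Suc 3 dvd order G"
        have "p ^ Suc 3 = p\<^sup>2 * p\<^sup>2" by (simp add: power2_eq_square numeral_3_eq_3)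
        then have "p\<^sup>2 * p\<^sup>2 dvd p\<^sup>2 * (2 * t)" using a 2 t by (simp add: mult.assoc mult.left_commute)
        moreover have "p\<^sup>2 \<noteq> 0" using p0 by simp
        ultimately have "p\<^sup>2 dvd 2 * t" using dvd_times_left_cancel_iff[of "p\<^sup>2" "p\<^sup>2" "2 * t"] by blast
        moreover have "p\<^sup>2 = 9 \<or> p\<^sup>2 = 25" using bounds by auto
        ultimately have "9 dvd 2 * t \<or> 25 dvd 2 * t" by auto
        then show False using tcases by auto
      qed
      then have "multiplicity q (order G) \<le> 3" by (rule multiplicity_le_if_not_dvd[OF q(1) o0])
      then have "multiplicity q (order G) \<le> multiplicity q (ord x) + 2" using ge1 by linarith
      then show ?thesis using 2 roots(3,5) by simp
    next
      case 3
      have "\<not> q ^ Suc 1 dvd order G"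
      proof
        assume a: "q ^ Suc 1 dvd order G"
        have "\<not> q dvd 2" using primes_dvd_imp_eq[OF q(1) two_is_prime_nat] 3 by blast
        moreover have "\<not> q dvd p\<^sup>2"
          using primes_dvd_imp_eq[OF q(1) p] prime_dvd_power[OF q(1), of p 2] 3 by blast
        ultimately have "\<not> q dvd 2 * p\<^sup>2" using q(1) prime_dvd_mult_iff by blast
        then have "coprime q (2 * p\<^sup>2)" using q(1) prime_imp_coprime by blast
        then have "coprime (q ^ Suc 1) (2 * p\<^sup>2)" by (simp only: coprime_power_left_iff) simp
        then have "q ^ Suc 1 dvd t" using a unfolding t by (simp only: coprime_dvd_mult_right_iff)
        then have "q * q \<le> 6" using dvd_imp_le[of "q ^ Suc 1" t] t0 tle by simp
        moreover have "3 * 3 \<le> q * q" using q1 3 by (intro mult_le_mono) linarith+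
        ultimately show False by simp
      qed
      then have "multiplicity q (order G) \<le> 1" by (rule multiplicity_le_if_not_dvd[OF q(1) o0])
      then show ?thesis using ge1 by linarith
    qed
  qed
  then obtain z and k :: nat where "z \<in> carrier G" "z \<otimes> x \<otimes> inv z = y [^] k" by blast
  then show False using root_count_eq_if_conj_cyclic[OF fin x y ordxy, of z k "2 * p"] r2p by simp
qed

lemma order_bound:
  assumes fin: "finite (carrier G)" and p: "Factorial_Ring.prime p" "odd p"
    and P: "property_P G (2 * p) x y"
    and bounds: "p = 3 \<and> order G < 96 \<or> p = 5 \<and> order G < 320"
  shows False
proof -
  have x: "x \<in> carrier G" and y: "y \<in> carrier G" and ordxy: "ord x = ord y"
    and eq: "\<And>l. squarefree l \<Longrightarrow> l < 2 * p \<Longrightarrow> root_count G l x = root_count G l y"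
    and r2p: "root_count G (2 * p) x < root_count G (2 * p) y"
    using P unfolding property_P_def by auto
  have p1: "p > 1" using p(1) prime_gt_1_nat by blast
  have r2: "root_count G 2 x = root_count G 2 y"
    by (rule eq) (use p1 in \<open>simp_all add: squarefree_prime\<close>)
  have rp: "root_count G p x = root_count G p y"
    by (rule eq) (use p1 p(1) in \<open>simp_all add: squarefree_prime\<close>)
  have p2: "\<not> p\<^sup>2 dvd order G"
    by (rule prime_square_not_dvd_order[OF fin p(1) bounds x y ordxy r2 rp r2p])
  obtain E :: "'a set monoid" and x' y' where E: "group E" "finite (carrier E)" "2 * p * order E \<le> order G"
    "\<not> p dvd order E" "x' \<in> carrier E" "y' \<in> carrier E" "group.ord E x' = group.ord E y'"
    "root_count E 2 x' < root_count E 2 y'" "root_count E 2 x' mod p = root_count E 2 y' mod p"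
    using reduction_to_central_quotient[OF fin p p2 x y ordxy r2 rp r2p] by blast
  have "p = 3 \<and> order E \<le> 15 \<or> p = 5 \<and> order E \<le> 31"
    using bounds E(3) by auto
  then show False using group.no_root_gap[OF E(1,2,5,6,7,8,9,4)] by blast
qed

end

theorem theorem4p2:
  fixes G :: "('a, 'b) monoid_scheme" and p :: nat
  assumes "Factorial_Ring.prime p" and "odd p"
    and "group G" and "finite (carrier G)"
    and "\<exists>x y. property_P G (2 * p) x y"
  shows "(p = 3 \<longrightarrow> order G \<ge> 96) \<and> (p = 5 \<longrightarrow> order G \<ge> 320)"
proof -
  obtain x y where P: "property_P G (2 * p) x y" using assms(5) by (elim exE)
  show ?thesis
  proof (rule ccontr)
    assume "\<not> ?thesis"
    then have "p = 3 \<and> order G < 96 \<or> p = 5 \<and> order G < 320" by auto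
    then show False by (rule group.order_bound[OF assms(3,4,1,2) P])
  qed
qed

end
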